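(* Let $p$ be a polynomial degree, and let $\gamma_0$ and $\gamma_1$ be the constants such that $h_K^d\le\gamma_0|K|$ for all $K\in\mathcal{T}_h$ and each interface piece $e_K=K\cap\Gamma$, $K\in\mathcal{T}_h^\Gamma$, is contained in a strip of width at most $\gamma_1h_K^2$. If $c_0\ge 2\gamma_0\gamma_1$ is chosen in the definition of the weights $$\kappa_i=\begin{cases}0,&\text{if } \frac{|K_i|}{|K|}<c_0h_K,\\ 1,&\text{if }\frac{|K_i|}{|K|}>1-c_0h_K,\\ \frac{|K_i|}{|K|},&\text{otherwise,}\end{cases}$$ then there exists a constant $h_0>0$ such that for all $h\in(0,h_0]$ and any interface segment/patch $e_K=K\cap\Gamma$ with $K\in\mathcal{T}_h^\Gamma$, the following estimates hold on both sub-elements $K_1,K_2$ of $K$: $$\|\kappa_i^{1/2}v_i\|_{L^2(e_K)}\le\frac{C}{h_K^{1/2}}\|v_i\|_{L^2(K_i)}\qquad\text{for all } v_i\in\mathcal{P}_p(K_i),\quad i=1,2,$$ where the constant $C$ is independent of $h$ and of the location of the interface relative to the mesh.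
   Context: $\Omega\subset\mathbb{R}^d$, $d\in\{2,3\}$, is a bounded convex polygonal/polyhedral domain; $\Gamma$ is a $C^2$-smooth internal interface dividing $\Omega$ into two open sets $\Omega_1,\Omega_2$, with $\Gamma=\partial\Omega_1$ and $\Gamma\cap\partial\Omega=\emptyset$. $\{\mathcal{T}_h\}$ is a family of conforming, quasi-uniform, shape-regular partitions of $\Omega$ into triangles and parallelograms ($d=2$) or tetrahedra and parallelepipeds ($d=3$), not fitted to $\Gamma$. $h_K=\operatorname{diam}K$, $h=\max_{K\in\mathcal{T}_h} h_K$; $|\cdot|$ is the measure of the appropriate dimension. $\mathcal{T}_h^\Gamma=\{K\in\mathcal{T}_h:|K\cap\Gamma|\ne0\}$, $K_i=K\cap\Omega_i$, and $\boldsymbol{n}_i$ is the unit outward normal on $\partial K_i$. Since $\Gamma$ is $C^2$, there are constants $\gamma_1,\gamma_2$ such that each $e_K$ lies in a strip (between two parallel lines/planes) of width $\delta\le\gamma_1h_K^2$ and $|\boldsymbol{n}_i(x)-\boldsymbol{n}_i(y)|\le\gamma_2h_K$ for all $x,y\in e_K$. $\mathcal{P}_p(K_i)$ denotes the restrictions to $K_i$ of polynomials of degree at most $p$; on $e_K$, $v_i$ means its trace from $K_i$. *)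

theory Defs
  imports "HOL-Analysis.Analysis"
begin

text \<open>
  The measure on the interface is the Hausdorff measure of dimension \<open>s = d - 1\<close>, normalised so that it
  agrees with the usual area of smooth hypersurfaces.
\<close>

definition hausdorff_cost :: "nat \<Rightarrow> 'a::metric_space set \<Rightarrow> ennreal" where
  "hausdorff_cost s U =
     (if U = {} then 0 else ennreal (unit_ball_vol (real s) * (diameter U / 2) ^ s))"

definition hausdorff_pre :: "nat \<Rightarrow> real \<Rightarrow> 'a::metric_space set \<Rightarrow> ennreal" where
  "hausdorff_pre s \<delta> A =
     (INF U \<in> {U :: nat \<Rightarrow> 'a set. A \<subseteq> (\<Union>i. U i) \<and> (\<forall>i. bounded (U i) \<and> diameter (U i) \<le> \<delta>)}.
        \<Sum>i. hausdorff_cost s (U i))"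

definition hausdorff_outer :: "nat \<Rightarrow> 'a::metric_space set \<Rightarrow> ennreal" where
  "hausdorff_outer s A = (SUP \<delta> \<in> {0<..}. hausdorff_pre s \<delta> A)"

definition hausdorff_measure :: "nat \<Rightarrow> 'a::metric_space measure" where
  "hausdorff_measure s = measure_of UNIV (sets borel) (hausdorff_outer s)"

abbreviation surface_measure :: "(real^'n) measure" where
  "surface_measure \<equiv> hausdorff_measure (CARD('n) - 1)"

lemma hausdorff_pre_le:
  assumes "A \<subseteq> (\<Union>i. U i)" "\<And>i. bounded (U i)" "\<And>i. diameter (U i) \<le> \<delta>"
  shows "hausdorff_pre s \<delta> A \<le> (\<Sum>i. hausdorff_cost s (U i))"
  unfolding hausdorff_pre_def using assms by (intro INF_lower) auto

lemma hausdorff_pre_antimono: "\<delta> \<le> \<delta>' \<Longrightarrow> hausdorff_pre s \<delta>' A \<le> hausdorff_pre s \<delta> A"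
  unfolding hausdorff_pre_def by (intro INF_superset_mono) (auto intro: order_trans)

lemma hausdorff_pre_mono: "A \<subseteq> B \<Longrightarrow> hausdorff_pre s \<delta> A \<le> hausdorff_pre s \<delta> B"
  unfolding hausdorff_pre_def by (intro INF_superset_mono) auto

lemma hausdorff_pre_empty: "0 \<le> \<delta> \<Longrightarrow> hausdorff_pre s \<delta> {} = 0"
  using hausdorff_pre_le[of "{}" "\<lambda>_. {}" \<delta> s] by (simp add: hausdorff_cost_def)

lemma hausdorff_pre_UN_le: "hausdorff_pre s \<delta> (\<Union>n. A n) \<le> (\<Sum>n. hausdorff_pre s \<delta> (A n))"
proof (rule ennreal_le_epsilon)
  fix e :: real assume e: "0 < e" and fin: "(\<Sum>n. hausdorff_pre s \<delta> (A n)) < top"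
  have "\<exists>U :: nat \<Rightarrow> 'a set. (A n \<subseteq> (\<Union>i. U i) \<and> (\<forall>i. bounded (U i) \<and> diameter (U i) \<le> \<delta>)) \<and>
      (\<Sum>i. hausdorff_cost s (U i)) < hausdorff_pre s \<delta> (A n) + e * (1/2)^Suc n" for n
  proof -
    have "hausdorff_pre s \<delta> (A n) < hausdorff_pre s \<delta> (A n) + e * (1/2)^Suc n"
      using e fin by (auto simp add: less_top dest!: ennreal_suminf_lessD)
    then show ?thesis
      unfolding hausdorff_pre_def[of s \<delta> "A n"] INF_less_iff by auto
  qed
  then obtain B :: "nat \<Rightarrow> nat \<Rightarrow> 'a set" where
    B: "\<And>n. A n \<subseteq> (\<Union>i. B n i)" "\<And>n i. bounded (B n i)" "\<And>n i. diameter (B n i) \<le> \<delta>"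
    and Ble: "\<And>n. (\<Sum>i. hausdorff_cost s (B n i)) < hausdorff_pre s \<delta> (A n) + e * (1/2)^Suc n"
    by metis
  define C where "C = case_prod B o prod_decode"
  have "(\<Union>i. A i) \<subseteq> (\<Union>i. C i)"
    using B(1) by (auto simp add: C_def subset_eq) (metis prod.case prod_encode_inverse)
  then have "hausdorff_pre s \<delta> (\<Union>n. A n) \<le> (\<Sum>i. hausdorff_cost s (C i))"
    using B by (intro hausdorff_pre_le) (auto simp: C_def split_beta)
  also have "\<dots> = (\<Sum>n. \<Sum>i. hausdorff_cost s (B n i))"
    unfolding C_def comp_def by (intro suminf_ennreal_2dimen) auto
  also have "\<dots> \<le> (\<Sum>n. hausdorff_pre s \<delta> (A n) + e * (1/2) ^ Suc n)"
    using Ble by (intro suminf_le) (auto intro: less_imp_le)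
  also have "... = (\<Sum>n. hausdorff_pre s \<delta> (A n)) + (\<Sum>n. ennreal e * ennreal ((1/2) ^ Suc n))"
    using \<open>0 < e\<close> by (subst suminf_add[symmetric])
                     (auto simp del: ennreal_suminf_cmult simp add: ennreal_mult[symmetric])
  also have "\<dots> = (\<Sum>n. hausdorff_pre s \<delta> (A n)) + e"
    unfolding ennreal_suminf_cmult
    by (subst suminf_ennreal_eq[OF zero_le_power power_half_series]) auto
  finally show "hausdorff_pre s \<delta> (\<Union>n. A n) \<le> (\<Sum>n. hausdorff_pre s \<delta> (A n)) + e" .
qed

lemma hausdorff_outer_mono: "A \<subseteq> B \<Longrightarrow> hausdorff_outer s A \<le> hausdorff_outer s B"
  unfolding hausdorff_outer_def by (intro SUP_mono' hausdorff_pre_mono)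

lemma hausdorff_outer_empty [simp]: "hausdorff_outer s {} = 0"
  by (auto simp: hausdorff_outer_def hausdorff_pre_empty)

lemma hausdorff_outer_UN_le:
  "hausdorff_outer s (\<Union>n::nat. A n) \<le> (\<Sum>n. hausdorff_outer s (A n))"
  unfolding hausdorff_outer_def[of s "\<Union>n. A n"]
proof (rule SUP_least)
  fix \<delta> :: real assume "\<delta> \<in> {0<..}"
  then have "(\<Sum>n. hausdorff_pre s \<delta> (A n)) \<le> (\<Sum>n. hausdorff_outer s (A n))"
    unfolding hausdorff_outer_def by (intro suminf_le SUP_upper) auto
  with hausdorff_pre_UN_le show "hausdorff_pre s \<delta> (\<Union>n. A n) \<le> (\<Sum>n. hausdorff_outer s (A n))"
    by (rule order_trans)
qed

lemma hausdorff_outer_Un_le: "hausdorff_outer s (A \<union> B) \<le> hausdorff_outer s A + hausdorff_outer s B"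
proof -
  define C where "C n = (if n = 0 then A else if n = 1 then B else {})" for n :: nat
  have "A \<union> B = (\<Union>n. C n)"
    by (auto simp: C_def split: if_splits)
  then have "hausdorff_outer s (A \<union> B) \<le> (\<Sum>n. hausdorff_outer s (C n))"
    using hausdorff_outer_UN_le by metis
  also have "\<dots> = (\<Sum>n\<in>{0, 1}. hausdorff_outer s (C n))"
    by (rule suminf_finite) (auto simp: C_def)
  also have "\<dots> = hausdorff_outer s A + hausdorff_outer s B"
    by (simp add: C_def)
  finally show ?thesis .
qed

lemma outer_measure_space_hausdorff_outer: "outer_measure_space (Pow UNIV) (hausdorff_outer s)"
  by (auto simp: outer_measure_space_def positive_def increasing_def countably_subadditive_def
      intro: hausdorff_outer_mono hausdorff_outer_UN_le)

lemma hausdorff_pre_separated: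
  assumes r: "\<And>x y. x \<in> A \<Longrightarrow> y \<in> B \<Longrightarrow> \<delta> < dist x y" and "0 \<le> \<delta>"
  shows "hausdorff_pre s \<delta> A + hausdorff_pre s \<delta> B \<le> hausdorff_pre s \<delta> (A \<union> B)"
  unfolding hausdorff_pre_def[of s \<delta> "A \<union> B"]
proof (rule INF_greatest, clarify)
  fix U :: "nat \<Rightarrow> 'a set"
  assume sub: "A \<union> B \<subseteq> (\<Union>i. U i)" and U: "\<forall>i. bounded (U i) \<and> diameter (U i) \<le> \<delta>"
  define V where "V i = (if U i \<inter> A = {} then {} else U i)" for i
  define W where "W i = (if U i \<inter> B = {} then {} else U i)" for i
  have "hausdorff_cost s (V i) + hausdorff_cost s (W i) \<le> hausdorff_cost s (U i)" for i
  proof -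
    have "U i \<inter> A = {} \<or> U i \<inter> B = {}"
      using r U by (meson diameter_bounded_bound disjoint_iff leD order_trans)
    then show ?thesis
      by (auto simp: V_def W_def hausdorff_cost_def)
  qed
  then have "(\<Sum>i. hausdorff_cost s (V i) + hausdorff_cost s (W i)) \<le> (\<Sum>i. hausdorff_cost s (U i))"
    by (intro suminf_le) auto
  moreover have "hausdorff_pre s \<delta> A \<le> (\<Sum>i. hausdorff_cost s (V i))"
  proof (rule hausdorff_pre_le)
    show "A \<subseteq> (\<Union>i. V i)"
    proof
      fix x assume "x \<in> A"
      with sub obtain i where "x \<in> U i" by auto
      with \<open>x \<in> A\<close> show "x \<in> (\<Union>i. V i)" by (auto simp: V_def intro!: exI[of _ i])
    qed
  qed (use U \<open>0 \<le> \<delta>\<close> in \<open>auto simp: V_def\<close>)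
  moreover have "hausdorff_pre s \<delta> B \<le> (\<Sum>i. hausdorff_cost s (W i))"
  proof (rule hausdorff_pre_le)
    show "B \<subseteq> (\<Union>i. W i)"
    proof
      fix x assume "x \<in> B"
      with sub obtain i where "x \<in> U i" by auto
      with \<open>x \<in> B\<close> show "x \<in> (\<Union>i. W i)" by (auto simp: W_def intro!: exI[of _ i])
    qed
  qed (use U \<open>0 \<le> \<delta>\<close> in \<open>auto simp: W_def\<close>)
  moreover have "(\<Sum>i. hausdorff_cost s (V i) + hausdorff_cost s (W i)) =
      (\<Sum>i. hausdorff_cost s (V i)) + (\<Sum>i. hausdorff_cost s (W i))"
    by (rule suminf_add[symmetric]) auto
  ultimately show "hausdorff_pre s \<delta> A + hausdorff_pre s \<delta> B \<le> (\<Sum>i. hausdorff_cost s (U i))"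
    by (metis add_mono order_trans)
qed

lemma hausdorff_outer_separated:
  assumes r: "0 < r" "\<And>x y. x \<in> A \<Longrightarrow> y \<in> B \<Longrightarrow> r \<le> dist x y"
  shows "hausdorff_outer s A + hausdorff_outer s B \<le> hausdorff_outer s (A \<union> B)"
proof -
  have "(SUP \<delta>\<in>{0<..}. hausdorff_pre s \<delta> A) + (SUP \<delta>\<in>{0<..}. hausdorff_pre s \<delta> B) =
        (SUP \<delta>\<in>{0<..}. hausdorff_pre s \<delta> A + hausdorff_pre s \<delta> B)"
  proof (rule SUP_add_directed_ennreal[symmetric])
    fix i j :: real assume "i \<in> {0<..}" "j \<in> {0<..}"
    then show "\<exists>k\<in>{0<..}. hausdorff_pre s i A + hausdorff_pre s j B
                 \<le> hausdorff_pre s k A + hausdorff_pre s k B"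
      by (intro bexI[of _ "min i j"] add_mono hausdorff_pre_antimono) auto
  qed
  also have "\<dots> \<le> hausdorff_outer s (A \<union> B)"
  proof (rule SUP_least)
    fix \<delta> :: real assume "\<delta> \<in> {0<..}"
    define \<epsilon> where "\<epsilon> = min \<delta> (r / 2)"
    have \<epsilon>: "0 < \<epsilon>" "\<epsilon> \<le> \<delta>" "\<epsilon> < r" using \<open>\<delta> \<in> {0<..}\<close> r(1) by (auto simp: \<epsilon>_def)
    have "hausdorff_pre s \<delta> A + hausdorff_pre s \<delta> B \<le> hausdorff_pre s \<epsilon> A + hausdorff_pre s \<epsilon> B"
      by (intro add_mono hausdorff_pre_antimono \<epsilon>)
    also have "\<dots> \<le> hausdorff_pre s \<epsilon> (A \<union> B)"
      using r(2) \<epsilon> by (intro hausdorff_pre_separated) (auto intro: less_le_trans)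
    also have "\<dots> \<le> hausdorff_outer s (A \<union> B)"
      unfolding hausdorff_outer_def using \<epsilon> by (intro SUP_upper) auto
    finally show "hausdorff_pre s \<delta> A + hausdorff_pre s \<delta> B \<le> hausdorff_outer s (A \<union> B)" .
  qed
  finally show ?thesis by (simp add: hausdorff_outer_def)
qed

lemma hausdorff_outer_separated_sum:
  assumes sep: "\<And>i j. i < j \<Longrightarrow> \<exists>r>0. \<forall>x\<in>R i. \<forall>y\<in>R j. r \<le> dist x y"
  shows "(\<Sum>i<n::nat. hausdorff_outer s (R i)) \<le> hausdorff_outer s (\<Union>i<n. R i)"
proof (induction n)
  case (Suc n)
  have "\<exists>r>0. \<forall>x\<in>(\<Union>i<m. R i). \<forall>y\<in>R n. r \<le> dist x y" if "m \<le> n" for m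
    using that
  proof (induction m)
    case 0
    show ?case by (auto intro: exI[of _ 1])
  next
    case (Suc m)
    then obtain r1 where r1: "r1 > 0" "\<And>i x y. i < m \<Longrightarrow> x \<in> R i \<Longrightarrow> y \<in> R n \<Longrightarrow> r1 \<le> dist x y"
      by auto
    obtain r2 where r2: "r2 > 0" "\<And>x y. x \<in> R m \<Longrightarrow> y \<in> R n \<Longrightarrow> r2 \<le> dist x y"
      using sep[of m n] Suc.prems by auto
    show ?case
    proof (intro exI[of _ "min r1 r2"] conjI ballI)
      fix x y assume "x \<in> (\<Union>i<Suc m. R i)" "y \<in> R n"
      then obtain i where "i = m \<or> i < m" "x \<in> R i" unfolding lessThan_Suc by blast
      then show "min r1 r2 \<le> dist x y"
        using r1(2)[of i x y] r2(2)[of x y] \<open>y \<in> R n\<close> by auto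
    qed (use r1(1) r2(1) in auto)
  qed
  then obtain r where r: "r > 0" "\<forall>x\<in>(\<Union>i<n. R i). \<forall>y\<in>R n. r \<le> dist x y" by blast
  have "(\<Sum>i<Suc n. hausdorff_outer s (R i)) \<le> hausdorff_outer s (\<Union>i<n. R i) + hausdorff_outer s (R n)"
    using Suc.IH by (simp add: add_right_mono)
  also have "\<dots> \<le> hausdorff_outer s ((\<Union>i<n. R i) \<union> R n)"
    using r by (intro hausdorff_outer_separated[of r]) auto
  also have "(\<Union>i<n. R i) \<union> R n = (\<Union>i<Suc n. R i)" by (auto simp: lessThan_Suc)
  finally show ?case .
qed simp

lemma hausdorff_outer_closed:
  fixes F E :: "'a::metric_space set"
  assumes "closed F"
  shows "hausdorff_outer s (E \<inter> F) + hausdorff_outer s (E - F) \<le> hausdorff_outer s E"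
proof (cases "F = {} \<or> hausdorff_outer s E = top")
  case True
  then show ?thesis by auto
next
  case False
  let ?\<mu> = "hausdorff_outer s :: 'a set \<Rightarrow> ennreal"
  have ne: "F \<noteq> {}" and fin: "?\<mu> E < top" using False by (auto simp: less_top)
  define D where "D n = {x \<in> E. 1 / real (Suc n) \<le> infdist x F}" for n
  define R where "R n = D (Suc n) - D n" for n
  have D_mono: "m \<le> n \<Longrightarrow> D m \<subseteq> D n" for m n
    by (auto simp: D_def elim!: order_trans[rotated] intro!: divide_left_mono)
  have main: "?\<mu> (E \<inter> F) + ?\<mu> (D n) \<le> ?\<mu> E" for n
  proof -
    have "?\<mu> (E \<inter> F) + ?\<mu> (D n) \<le> ?\<mu> (E \<inter> F \<union> D n)"
    proof (rule hausdorff_outer_separated[of "1 / real (Suc n)"])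
      fix x y assume "x \<in> E \<inter> F" "y \<in> D n"
      then show "1 / real (Suc n) \<le> dist x y"
        using infdist_le[of x F y] by (auto simp: D_def dist_commute)
    qed simp
    also have "\<dots> \<le> ?\<mu> E" by (intro hausdorff_outer_mono) (auto simp: D_def)
    finally show ?thesis .
  qed
  have gap: "\<exists>r>0. \<forall>x\<in>R i. \<forall>y\<in>R j. r \<le> dist x y" if "Suc i < j" for i j
  proof (intro exI[of _ "1 / real (Suc (Suc i)) - 1 / real (Suc j)"] conjI ballI)
    show "0 < 1 / real (Suc (Suc i)) - 1 / real (Suc j)"
      using that by (simp add: divide_strict_left_mono)
    fix x y assume "x \<in> R i" "y \<in> R j"
    then have "1 / real (Suc (Suc i)) \<le> infdist x F" "infdist y F \<le> 1 / real (Suc j)"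
      by (auto simp: R_def D_def)
    then show "1 / real (Suc (Suc i)) - 1 / real (Suc j) \<le> dist x y"
      using infdist_triangle[of x F y] by linarith
  qed
  have bd: "(\<Sum>i. ?\<mu> (R (2 * i + k))) \<le> ?\<mu> E" for k
  proof (rule suminf_le_const)
    fix n
    have "(\<Sum>i<n. ?\<mu> (R (2 * i + k))) \<le> ?\<mu> (\<Union>i<n. R (2 * i + k))"
      by (rule hausdorff_outer_separated_sum) (rule gap, simp)
    also have "\<dots> \<le> ?\<mu> E" by (intro hausdorff_outer_mono) (auto simp: R_def D_def)
    finally show "(\<Sum>i<n. ?\<mu> (R (2 * i + k))) \<le> ?\<mu> E" .
  qed auto
  have eq: "(\<Sum>i<2 * n. ?\<mu> (R i)) = (\<Sum>i<n. ?\<mu> (R (2 * i))) + (\<Sum>i<n. ?\<mu> (R (2 * i + 1)))" for n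
    by (induction n) (auto simp: algebra_simps)
  have le: "(\<Sum>i<n. ?\<mu> (R (2 * i + k))) \<le> ?\<mu> E" for n k
    using sum_le_suminf[of "\<lambda>i. ?\<mu> (R (2 * i + k))" "{..<n}"] bd[of k] by (auto intro: order_trans)
  have even_le: "(\<Sum>i<2 * n. ?\<mu> (R i)) \<le> ?\<mu> E + ?\<mu> E" for n
    unfolding eq using le[of 0 n] le[of 1 n] by (intro add_mono) simp_all
  have "(\<Sum>i. ?\<mu> (R i)) \<le> ?\<mu> E + ?\<mu> E"
  proof (rule suminf_le_const)
    fix n
    have "(\<Sum>i<n. ?\<mu> (R i)) \<le> (\<Sum>i<2 * n. ?\<mu> (R i))" by (intro sum_mono2) auto
    with even_le show "(\<Sum>i<n. ?\<mu> (R i)) \<le> ?\<mu> E + ?\<mu> E" by (rule order_trans[rotated])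
  qed auto
  with fin have sumfin: "(\<Sum>i. ?\<mu> (R i)) \<noteq> top"
    by (metis ennreal_add_eq_top less_top top.extremum_unique)
  have tail: "E - F \<subseteq> D n \<union> (\<Union>i. R (i + n))" for n
  proof
    fix x assume x: "x \<in> E - F"
    then have "0 < infdist x F"
      using assms ne by (metis DiffD2 in_closed_iff_infdist_zero infdist_nonneg order_le_less)
    then obtain m where "1 / real (Suc m) < infdist x F"
      using nat_approx_posE by blast
    then have ex: "\<exists>m. x \<in> D m" using x by (auto simp: D_def intro: less_imp_le)
    define m where "m = (LEAST m. x \<in> D m)"
    have m: "x \<in> D m" unfolding m_def using ex by (rule LeastI_ex)
    show "x \<in> D n \<union> (\<Union>i. R (i + n))"
    proof (cases "m \<le> n")
      case True with m D_mono show ?thesis by auto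
    next
      case False
      then obtain k where k: "m = Suc (k + n)"
        by (metis add.commute add_Suc_right less_imp_Suc_add not_le)
      then have "x \<notin> D (k + n)" using not_less_Least[of "k + n" "\<lambda>m. x \<in> D m"] unfolding m_def by auto
      with m k have "x \<in> R (k + n)" by (auto simp: R_def)
      then show ?thesis by auto
    qed
  qed
  have "(\<lambda>n. \<Sum>i. ?\<mu> (R (i + n))) \<longlonglongrightarrow> 0"
  proof -
    define a where "a i = enn2real (?\<mu> (R i))" for i
    have a: "?\<mu> (R i) = ennreal (a i)" "0 \<le> a i" for i
    proof -
      have "?\<mu> (R i) \<noteq> top" using sumfin by (metis ennreal_suminf_lessD less_top)
      then show "?\<mu> (R i) = ennreal (a i)" by (simp add: a_def less_top)
    qed (simp add: a_def)
    have sm: "summable a"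
      using sumfin a by (intro summable_suminf_not_top) auto
    have "(\<lambda>n. ennreal (\<Sum>i. a (i + n))) \<longlonglongrightarrow> ennreal 0"
      using suminf_exist_split2[OF sm] by (intro tendsto_ennrealI)
    moreover have "(\<Sum>i. ennreal (a (i + n))) = ennreal (\<Sum>i. a (i + n))" for n
      using sm a by (intro suminf_ennreal2) (auto simp: summable_iff_shift)
    ultimately show ?thesis by (simp add: a)
  qed
  then have "(\<lambda>n. ?\<mu> E + (\<Sum>i. ?\<mu> (R (i + n)))) \<longlonglongrightarrow> ?\<mu> E + 0"
    by (intro tendsto_add) auto
  moreover have "?\<mu> (E \<inter> F) + ?\<mu> (E - F) \<le> ?\<mu> E + (\<Sum>i. ?\<mu> (R (i + n)))" for n
  proof -
    have "?\<mu> (E - F) \<le> ?\<mu> (D n) + ?\<mu> (\<Union>i. R (i + n))"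
      using hausdorff_outer_mono[OF tail] hausdorff_outer_Un_le by (rule order_trans)
    also have "\<dots> \<le> ?\<mu> (D n) + (\<Sum>i. ?\<mu> (R (i + n)))"
      by (intro add_left_mono hausdorff_outer_UN_le)
    finally have "?\<mu> (E \<inter> F) + ?\<mu> (E - F) \<le> (?\<mu> (E \<inter> F) + ?\<mu> (D n)) + (\<Sum>i. ?\<mu> (R (i + n)))"
      by (simp add: add.assoc add_left_mono)
    also have "\<dots> \<le> ?\<mu> E + (\<Sum>i. ?\<mu> (R (i + n)))"
      by (intro add_right_mono main)
    finally show ?thesis .
  qed
  ultimately show ?thesis
    by (intro LIMSEQ_le_const) auto
qed

lemma measure_space_hausdorff_outer:
  "measure_space UNIV (sets borel) (hausdorff_outer s :: 'a::metric_space set \<Rightarrow> ennreal)"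
proof -
  let ?L = "lambda_system UNIV (Pow UNIV) (hausdorff_outer s :: 'a set \<Rightarrow> ennreal)"
  have L: "measure_space UNIV ?L (hausdorff_outer s)"
    by (rule sigma_algebra.caratheodory_lemma[OF sigma_algebra_Pow outer_measure_space_hausdorff_outer])
  have "Collect closed \<subseteq> ?L"
  proof clarify
    fix F :: "'a set" assume F: "closed F"
    have "hausdorff_outer s (E \<inter> F) + hausdorff_outer s (E - F) = hausdorff_outer s E" for E
    proof (rule antisym[OF hausdorff_outer_closed[OF F]])
      have "E = (E \<inter> F) \<union> (E - F)" by auto
      then show "hausdorff_outer s E \<le> hausdorff_outer s (E \<inter> F) + hausdorff_outer s (E - F)"
        using hausdorff_outer_Un_le[of s "E \<inter> F" "E - F"] by simp
    qed
    then show "F \<in> ?L"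
      using algebra.lambda_system_eq[OF algebra_Pow, of UNIV "hausdorff_outer s :: 'a set \<Rightarrow> ennreal"]
      by auto
  qed
  then have "sigma_sets UNIV (Collect closed) \<subseteq> ?L"
    using L by (intro sigma_algebra.sigma_sets_subset) (auto simp: measure_space_def)
  then have "sets (borel :: 'a measure) \<subseteq> ?L"
    by (simp add: borel_eq_closed)
  moreover have "sigma_algebra UNIV (sets (borel :: 'a measure))"
    using sets.sigma_algebra_axioms[of "borel :: 'a measure"] by simp
  ultimately show ?thesis
    using measure_down[OF L] by blast
qed

text \<open>
  By Caratheodory's criterion the outer measure is a measure on the Borel sets, so the
  \<^const>\<open>measure_of\<close> construction above does not degenerate to the zero measure.
\<close>

lemma sets_hausdorff_measure [simp, measurable_cong]: "sets (hausdorff_measure s) = sets borel"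
  unfolding hausdorff_measure_def
  using sigma_algebra.sets_measure_of_eq[OF sets.sigma_algebra_axioms[of borel]] by simp

lemma space_hausdorff_measure [simp]: "space (hausdorff_measure s) = UNIV"
  by (simp add: hausdorff_measure_def space_measure_of_conv)

lemma emeasure_hausdorff_measure:
  assumes "A \<in> sets borel"
  shows "emeasure (hausdorff_measure s) A = hausdorff_outer s A"
  unfolding hausdorff_measure_def
  using measure_space_hausdorff_outer[of s, where 'a='a] assms
  by (intro emeasure_measure_of_sigma) (auto simp: measure_space_def)

text \<open>Extended-valued, so that a function that is not square integrable has infinite norm.\<close>

definition L2_norm_on :: "'a measure \<Rightarrow> 'a set \<Rightarrow> ('a \<Rightarrow> real) \<Rightarrow> ennreal" where
  "L2_norm_on M A f =
     (let I = (\<integral>\<^sup>+ x. ennreal ((f x)\<^sup>2) * indicator A x \<partial>M)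
      in if I = \<infinity> then \<infinity> else ennreal (sqrt (enn2real I)))"


definition polytopal_domain :: "(real^'n) set \<Rightarrow> bool" where
  "polytopal_domain \<Omega> \<longleftrightarrow>
     \<Omega> \<noteq> {} \<and> open \<Omega> \<and> bounded \<Omega> \<and> convex \<Omega> \<and> polytope (closure \<Omega>)"

text \<open>Locally a regular level set: \<open>G\<close> is the gradient and \<open>H\<close> the continuous Hessian of \<open>\<phi>\<close>.\<close>

definition C2_hypersurface :: "(real^'n) set \<Rightarrow> bool" where
  "C2_hypersurface \<Gamma> \<longleftrightarrow>
     (\<forall>x\<in>\<Gamma>. \<exists>U \<phi> (G :: real^'n \<Rightarrow> real^'n) (H :: real^'n \<Rightarrow> real^'n^'n).
        open U \<and> x \<in> U \<and>
        (\<forall>y\<in>U. (\<phi> has_derivative (\<lambda>v. G y \<bullet> v)) (at y)) \<and>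
        (\<forall>y\<in>U. (G has_derivative (\<lambda>v. H y *v v)) (at y)) \<and>
        continuous_on U H \<and>
        (\<forall>y\<in>U. G y \<noteq> 0) \<and>
        \<Gamma> \<inter> U = {y\<in>U. \<phi> y = 0})"

definition C2_interface ::
  "(real^'n) set \<Rightarrow> (real^'n) set \<Rightarrow> (real^'n) set \<Rightarrow> (real^'n) set \<Rightarrow> bool" where
  "C2_interface \<Omega> \<Gamma> \<Omega>1 \<Omega>2 \<longleftrightarrow>
     open \<Omega>1 \<and> open \<Omega>2 \<and> \<Omega>1 \<inter> \<Omega>2 = {} \<and> \<Omega>1 \<union> \<Omega>2 = \<Omega> - \<Gamma> \<and>
     \<Gamma> = frontier \<Omega>1 \<and> \<Gamma> \<inter> frontier \<Omega> = {} \<and> C2_hypersurface \<Gamma>"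


definition parallelotope :: "(real^'n) set \<Rightarrow> bool" where
  "parallelotope K \<longleftrightarrow>
     (\<exists>(A :: real^'n^'n) b. invertible A \<and> K = (\<lambda>t. b + A *v t) ` cbox 0 1)"

definition mesh_element :: "(real^'n) set \<Rightarrow> bool" where
  "mesh_element K \<longleftrightarrow> int CARD('n) simplex K \<or> parallelotope K"

text \<open>
  Elements are closed sets. Two distinct elements of a conforming partition meet in a common face, possibly the empty one.
\<close>

definition conforming_partition :: "(real^'n) set \<Rightarrow> (real^'n) set set \<Rightarrow> bool" where
  "conforming_partition \<Omega> T \<longleftrightarrow>
     finite T \<and> (\<forall>K\<in>T. mesh_element K) \<and> \<Union>T = closure \<Omega> \<and>
     (\<forall>K\<in>T. \<forall>K'\<in>T. K \<inter> K' face_of K \<and> K \<inter> K' face_of K')"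

definition mesh_size :: "(real^'n) set set \<Rightarrow> real" where
  "mesh_size T = Max (diameter ` T)"

definition inscribed_diameter :: "(real^'n) set \<Rightarrow> real" where
  "inscribed_diameter K = Sup {2 * r |r x. 0 \<le> r \<and> cball x r \<subseteq> K}"

definition shape_regular :: "(real^'n) set set set \<Rightarrow> bool" where
  "shape_regular \<T> \<longleftrightarrow>
     (\<exists>\<sigma>>0. \<forall>T\<in>\<T>. \<forall>K\<in>T. diameter K \<le> \<sigma> * inscribed_diameter K)"

definition quasi_uniform :: "(real^'n) set set set \<Rightarrow> bool" where
  "quasi_uniform \<T> \<longleftrightarrow>
     (\<exists>\<tau>>0. \<forall>T\<in>\<T>. \<forall>K\<in>T. mesh_size T \<le> \<tau> * diameter K)"

text \<open>The constants in shape regularity and quasi-uniformity are uniform over the whole family.\<close>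

definition mesh_family :: "(real^'n) set \<Rightarrow> (real^'n) set set set \<Rightarrow> bool" where
  "mesh_family \<Omega> \<T> \<longleftrightarrow>
     (\<forall>T\<in>\<T>. conforming_partition \<Omega> T) \<and> shape_regular \<T> \<and> quasi_uniform \<T>"

definition cut_elements :: "(real^'n) set \<Rightarrow> (real^'n) set set \<Rightarrow> (real^'n) set set" where
  "cut_elements \<Gamma> T = {K\<in>T. emeasure surface_measure (K \<inter> \<Gamma>) \<noteq> 0}"

definition in_strip_of_width :: "real \<Rightarrow> (real^'n) set \<Rightarrow> bool" where
  "in_strip_of_width \<delta> S \<longleftrightarrow>
     (\<exists>n t. norm n = 1 \<and> S \<subseteq> {x. t \<le> n \<bullet> x \<and> n \<bullet> x \<le> t + \<delta>})"


definition weight :: "real \<Rightarrow> (real^'n) set \<Rightarrow> (real^'n) set \<Rightarrow> real" where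
  "weight c0 K D =
     (let r = measure lborel (K \<inter> D) / measure lborel K
      in if r < c0 * diameter K then 0
         else if r > 1 - c0 * diameter K then 1
         else r)"

text \<open>
  Polynomials of total degree at most \<open>p\<close>, as functions on the whole space. An element of
  \<open>\<P>\<^sub>p(K\<^sub>i)\<close> is represented by such a polynomial; its trace on the interface piece
  is then given by the values of the same polynomial.
\<close>

definition polynomials_upto :: "nat \<Rightarrow> (real^'n \<Rightarrow> real) set" where
  "polynomials_upto p =
     {v. \<exists>c :: ('n \<Rightarrow> nat) \<Rightarrow> real.
        v = (\<lambda>x. \<Sum>\<alpha> | (\<Sum>j\<in>UNIV. \<alpha> j) \<le> p. c \<alpha> * (\<Prod>j\<in>UNIV. (x $ j) ^ \<alpha> j))}"

end

theory Submission
  imports Defs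
begin

text \<open>
  Write \<open>h\<close> for the diameter of a cut element \<open>K\<close>, \<open>e = K \<inter> \<Gamma>\<close>, and \<open>d\<close> for the dimension. If the weight of the
  phase \<open>D\<close> vanishes there is nothing to prove. Otherwise \<open>|K \<inter> D| \<ge> c0 h |K|\<close>, and the proof
  replaces the trace inequality by a supremum bound,
  \<open>sup\<^sub>e v\<^sup>2 \<le> M / |K \<inter> D| \<integral>\<^bsub>K \<inter> D\<^esub> v\<^sup>2\<close> with \<open>M\<close> depending only on \<open>p\<close> and \<open>d\<close>
  (lemma \<open>pointwise_bound_on_interface\<close>). Integrating it over \<open>e\<close>, the area of \<open>e\<close> contributes a factor of order
  \<open>h\<^sup>d\<^sup>-\<^sup>1\<close>, and the weight, for small \<open>h\<close> at most \<open>2 |K \<inter> D| / |K|\<close>, cancels the denominator. What is left is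
  \<open>h\<^sup>d\<^sup>-\<^sup>1 / |K|\<close>, of order \<open>1 / h\<close>.

  The supremum bound rests on two facts. The first is geometric
  (\<open>one_cap_carries_phase\<close>): the strip containing \<open>e\<close> meets \<open>K\<close> in volume at most
  \<open>\<gamma>1 h\<^sup>2 h\<^sup>d\<^sup>-\<^sup>1 \<le> \<gamma>0 \<gamma>1 h |K|\<close>, which is at most half of \<open>|K \<inter> D|\<close> because \<open>c0 \<ge> 2 \<gamma>0 \<gamma>1\<close>. The two caps of
  \<open>K\<close> on either side of the strip are convex and miss \<open>\<Gamma>\<close>, so each lies in one phase, and one of those
  in \<open>D\<close> has at least a quarter of the volume of \<open>K \<inter> D\<close>.

  The second is an inverse estimate on that cap \<open>W\<close>, evaluated at points of \<open>e\<close>, hence slightly outside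
  \<open>W\<close> (\<open>pointwise_bound_by_L2_on_cap\<close>). The cap may be much flatter than \<open>K\<close>, so no reference element is
  used. Instead \<open>v x\<close> is extrapolated by one-dimensional Lagrange interpolation along the
  segments from \<open>x\<close> into the upper half of \<open>W\<close>, and the result is averaged over all these segments. This
  is possible because the volume of \<open>W\<close> forces its height to be comparable with the width of the strip
  or larger.

  The area bound for \<open>e\<close> (\<open>compact_C2_hypersurface_small_piece_area\<close>) holds because at a small scale \<open>\<Gamma>\<close> is
  a Lipschitz graph over a coordinate hyperplane with a universal constant. This scale is how \<open>h0\<close> depends on
  \<open>\<Gamma>\<close>, while \<open>C\<close> does not.
\<close>

section \<open>Pointwise bounds for polynomials by mean squares\<close>

lemma lagrange_evaluation_at_zero:
  fixes s :: "nat \<Rightarrow> real"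
  assumes inj: "inj_on s {..p}"
  shows "\<exists>c. \<forall>q :: real poly. degree q \<le> p \<longrightarrow> poly q 0 = (\<Sum>j\<le>p. c j * poly q (s j))"
proof -
  \<comment> \<open>the Lagrange basis for the nodes\<close>
  define L where "L j = (\<Prod>i\<in>{..p} - {j}. [: - s i / (s j - s i), 1 / (s j - s i) :])" for j
  have L_deg: "degree (L j) \<le> p" if "j \<le> p" for j
  proof -
    have "degree (L j) \<le> (\<Sum>i\<in>{..p} - {j}. 1)"
      unfolding L_def by (intro order_trans[OF degree_prod_sum_le] sum_mono) auto
    also have "\<dots> = p" using that by simp
    finally show ?thesis .
  qed
  have L_node: "poly (L j) (s i) = (if i = j then 1 else 0)" if "i \<le> p" "j \<le> p" for i j
  proof (cases "i = j")
    case True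
    have "poly (L j) (s j) = (\<Prod>i\<in>{..p} - {j}. 1)"
      unfolding L_def poly_prod
    proof (rule prod.cong)
      fix k assume k: "k \<in> {..p} - {j}"
      then have "s j - s k \<noteq> 0" using inj that by (auto dest: inj_onD)
      moreover have "poly [: - s k / d, 1 / d :] (s j) = (s j - s k) / d" for d
        by (simp add: diff_divide_distrib)
      ultimately show "poly [: - s k / (s j - s k), 1 / (s j - s k) :] (s j) = 1" by simp
    qed simp
    with True show ?thesis by simp
  next
    case False
    have "poly (L j) (s i) = 0" unfolding L_def poly_prod
      by (rule prod_zero, simp, rule bexI[of _ i]) (use that False in \<open>auto simp: field_simps\<close>)
    with False show ?thesis by simp
  qed
  have "q = (\<Sum>j\<le>p. smult (poly q (s j)) (L j))" if "degree q \<le> p" for q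
  proof (rule poly_eqI_degree[where A = "s ` {..p}"])
    show "poly q x = poly (\<Sum>j\<le>p. smult (poly q (s j)) (L j)) x" if "x \<in> s ` {..p}" for x
    proof -
      obtain i where i: "i \<le> p" "x = s i" using \<open>x \<in> s ` {..p}\<close> by auto
      have "poly (\<Sum>j\<le>p. smult (poly q (s j)) (L j)) x = (\<Sum>j\<le>p. poly q (s j) * (if i = j then 1 else 0))"
        using i L_node by (auto simp: poly_sum intro!: sum.cong)
      also have "\<dots> = (\<Sum>j\<le>p. if i = j then poly q (s j) else 0)" by (intro sum.cong) auto
      also have "\<dots> = poly q x" using i by (simp add: sum.delta)
      finally show ?thesis by simp
    qed
    have card: "card (s ` {..p}) = Suc p" by (simp add: card_image[OF inj])
    show "degree q < card (s ` {..p})" using that card by simp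
    have "degree (\<Sum>j\<le>p. smult (poly q (s j)) (L j)) \<le> p"
      by (intro degree_sum_le) (auto intro: order_trans[OF degree_smult_le] L_deg)
    then show "degree (\<Sum>j\<le>p. smult (poly q (s j)) (L j)) < card (s ` {..p})" using card by simp
  qed
  note interpolation = this
  have "poly q 0 = (\<Sum>j\<le>p. poly (L j) 0 * poly q (s j))" if "degree q \<le> p" for q
  proof -
    have "poly q 0 = poly (\<Sum>j\<le>p. smult (poly q (s j)) (L j)) 0"
      by (rule arg_cong[where f = "\<lambda>r. poly r 0"], rule interpolation[OF that])
    also have "\<dots> = (\<Sum>j\<le>p. poly (L j) 0 * poly q (s j))"
      by (simp add: poly_sum mult.commute)
    finally show ?thesis .
  qed
  then show ?thesis by (intro exI[of _ "\<lambda>j. poly (L j) 0"]) auto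
qed

text \<open>
  A polynomial of degree at most \<open>p\<close> is determined by its values at any \<open>p + 1\<close> points, so its value
  at \<open>0\<close> is controlled by its values at \<open>p + 1\<close> nodes of \<open>[\<rho>, 1]\<close>. Keeping the nodes away from \<open>0\<close> is what
  makes the bound an extrapolation: it will be used on segments that enter a region of interest
  only after a fixed fraction of their length.
\<close>

lemma extrapolation_nodes:
  fixes \<rho> :: real
  assumes "\<rho> < 1"
  shows "\<exists>E>0. \<exists>s. (\<forall>j\<le>p. s j \<in> {\<rho>..1}) \<and>
    (\<forall>q :: real poly. degree q \<le> p \<longrightarrow> (poly q 0)\<^sup>2 \<le> E * (\<Sum>j\<le>p. (poly q (s j))\<^sup>2))"
proof -
  define s where "s j = 1 - (1 - \<rho>) * (real j / real (Suc p))" for j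
  have "inj_on s {..p}" using assms by (auto simp: s_def inj_on_def)
  from lagrange_evaluation_at_zero[OF this] obtain c where
    c: "\<And>q :: real poly. degree q \<le> p \<Longrightarrow> poly q 0 = (\<Sum>j\<le>p. c j * poly q (s j))" by blast
  define E where "E = (\<Sum>j\<le>p. (c j)\<^sup>2) + 1"
  have "E > 0" unfolding E_def by (intro add_nonneg_pos sum_nonneg) auto
  moreover have "s j \<in> {\<rho>..1}" if "j \<le> p" for j
  proof -
    have "real j / real (Suc p) \<le> 1" using that by simp
    then have "(1 - \<rho>) * (real j / real (Suc p)) \<le> (1 - \<rho>) * 1"
      using assms by (intro mult_left_mono) auto
    moreover have "0 \<le> (1 - \<rho>) * (real j / real (Suc p))"
      using assms by (intro mult_nonneg_nonneg) auto
    ultimately show ?thesis by (auto simp: s_def)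
  qed
  moreover have "(poly q 0)\<^sup>2 \<le> E * (\<Sum>j\<le>p. (poly q (s j))\<^sup>2)" if "degree q \<le> p" for q :: "real poly"
  proof -
    have "(poly q 0)\<^sup>2 \<le> (\<Sum>j\<le>p. (c j)\<^sup>2) * (\<Sum>j\<le>p. (poly q (s j))\<^sup>2)"
      unfolding c[OF that] by (rule Cauchy_Schwarz_ineq_sum)
    also have "\<dots> \<le> E * (\<Sum>j\<le>p. (poly q (s j))\<^sup>2)"
      unfolding E_def by (intro mult_right_mono sum_nonneg) auto
    finally show ?thesis .
  qed
  ultimately show ?thesis by blast
qed

lemma polynomials_upto_on_line:
  fixes v :: "real^'n \<Rightarrow> real"
  assumes "v \<in> polynomials_upto p"
  shows "\<exists>q. degree q \<le> p \<and> (\<forall>s. v (x + s *\<^sub>R w) = poly q s)"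
proof -
  obtain c :: "('n \<Rightarrow> nat) \<Rightarrow> real" where
    v: "v = (\<lambda>x. \<Sum>\<alpha> | (\<Sum>j\<in>UNIV. \<alpha> j) \<le> p. c \<alpha> * (\<Prod>j\<in>UNIV. (x $ j) ^ \<alpha> j))"
    using assms by (auto simp: polynomials_upto_def)
  define q where "q = (\<Sum>\<alpha> | (\<Sum>j\<in>UNIV. \<alpha> j) \<le> p. smult (c \<alpha>) (\<Prod>j\<in>UNIV. [:x $ j, w $ j:] ^ \<alpha> j))"
  have mono: "degree (smult (c \<alpha>) (\<Prod>j\<in>UNIV. [:x $ j, w $ j:] ^ \<alpha> j)) \<le> p"
    if "(\<Sum>j\<in>UNIV. \<alpha> j) \<le> p" for \<alpha>
  proof -
    have "degree (\<Prod>j\<in>UNIV. [:x $ j, w $ j:] ^ \<alpha> j) \<le> (\<Sum>j\<in>UNIV. degree ([:x $ j, w $ j:] ^ \<alpha> j))"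
      using degree_prod_sum_le[of UNIV "\<lambda>j. [:x $ j, w $ j:] ^ \<alpha> j"] by (simp add: o_def)
    also have "\<dots> \<le> (\<Sum>j\<in>UNIV. 1 * \<alpha> j)"
      by (intro sum_mono order_trans[OF degree_power_le] mult_right_mono) auto
    finally show ?thesis using that by (auto intro: order_trans[OF degree_smult_le])
  qed
  have "degree q \<le> p"
  proof (cases "finite {\<alpha> :: 'n \<Rightarrow> nat. (\<Sum>j\<in>UNIV. \<alpha> j) \<le> p}")
    case True
    then show ?thesis unfolding q_def by (intro degree_sum_le) (auto simp: mono simp del: degree_smult_eq)
  qed (simp add: q_def)
  moreover have "v (x + s *\<^sub>R w) = poly q s" for s
    by (simp add: v q_def poly_sum poly_prod)
  ultimately show ?thesis by blast
qed

lemma polynomials_upto_borel_measurable: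
  fixes v :: "real^'n \<Rightarrow> real"
  assumes "v \<in> polynomials_upto p"
  shows "v \<in> borel_measurable borel"
proof -
  have "continuous_on UNIV v"
    using assms by (auto simp: polynomials_upto_def intro!: continuous_intros)
  then show ?thesis by (rule borel_measurable_continuous_onI)
qed

lemma nn_integral_lborel_affine:
  fixes g :: "'a::euclidean_space \<Rightarrow> ennreal"
  assumes [measurable]: "g \<in> borel_measurable borel" and "r \<noteq> 0"
  shows "(\<integral>\<^sup>+ y. g y \<partial>lborel) = ennreal (\<bar>r\<bar> ^ DIM('a)) * (\<integral>\<^sup>+ y. g (b + r *\<^sub>R y) \<partial>lborel)"
  by (subst lborel_affine[OF assms(2), of b])
    (simp add: nn_integral_density nn_integral_distr nn_integral_cmult)

text \<open>
  The argument never maps \<open>W\<close> to a reference shape, so the constant is the same for all \<open>W\<close>, however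
  thin. For every \<open>y \<in> W\<close> the value \<open>v x\<close> is extrapolated along the segment from
  \<open>x\<close> to the midpoint of \<open>a\<close> and \<open>y\<close>, from nodes that by hypothesis lie in \<open>W\<close>. Each node depends on \<open>y\<close>
  through a homothety of ratio at least \<open>\<rho> / 2\<close>, so averaging over \<open>y \<in> W\<close> turns every nodal value into an
  integral of \<open>v\<^sup>2\<close> over a subset of \<open>W\<close>, at the cost of a factor at most \<open>(2 / \<rho>)\<^sup>d\<close>. The point \<open>x\<close> itself may
  lie outside \<open>W\<close>.
\<close>

lemma pointwise_bound_by_L2_on_star:
  fixes \<rho> :: real
  assumes \<rho>: "0 < \<rho>" "\<rho> < 1"
  shows "\<exists>M>0. \<forall>v\<in>polynomials_upto p. \<forall>W (x :: real^'n) a.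
    W \<in> sets borel \<longrightarrow> (\<forall>y\<in>W. \<forall>s\<in>{\<rho>..1}. x + s *\<^sub>R ((1/2) *\<^sub>R (a + y) - x) \<in> W) \<longrightarrow>
    ennreal ((v x)\<^sup>2) * emeasure lborel W
      \<le> ennreal M * (\<integral>\<^sup>+ y. ennreal ((v y)\<^sup>2) * indicator W y \<partial>lborel)"
proof -
  obtain E s where E: "E > 0" and s: "\<And>j. j \<le> p \<Longrightarrow> s j \<in> {\<rho>..1}"
    and ext: "\<And>q :: real poly. degree q \<le> p \<Longrightarrow> (poly q 0)\<^sup>2 \<le> E * (\<Sum>j\<le>p. (poly q (s j))\<^sup>2)"
    using extrapolation_nodes[OF \<rho>(2), of p] by blast
  define B where "B = (2 / \<rho>) ^ CARD('n)"
  have B: "B > 0" using \<rho> by (simp add: B_def)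
  define M where "M = E * (real (Suc p) * B)"
  have "ennreal ((v x)\<^sup>2) * emeasure lborel W
      \<le> ennreal M * (\<integral>\<^sup>+ y. ennreal ((v y)\<^sup>2) * indicator W y \<partial>lborel)"
    if v: "v \<in> polynomials_upto p" and W[measurable]: "W \<in> sets borel"
      and star: "\<forall>y\<in>W. \<forall>s\<in>{\<rho>..1}. x + s *\<^sub>R ((1/2) *\<^sub>R (a + y) - x) \<in> W"
    for v :: "real^'n \<Rightarrow> real" and W x a
  proof -
    note [measurable] = polynomials_upto_borel_measurable[OF v]
    define g where "g y = ennreal ((v y)\<^sup>2) * indicator W y" for y
    have [measurable]: "g \<in> borel_measurable borel" by (simp add: g_def[abs_def])
    define I where "I = (\<integral>\<^sup>+ y. g y \<partial>lborel)"
    define b where "b j = (1 - s j) *\<^sub>R x + (s j / 2) *\<^sub>R a" for j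
    have shift: "x + t *\<^sub>R ((1/2) *\<^sub>R (a + y) - x) = (1 - t) *\<^sub>R x + (t / 2) *\<^sub>R a + (t / 2) *\<^sub>R y" for t y
      by (simp add: algebra_simps)
    have pw: "ennreal ((v x)\<^sup>2) * indicator W y \<le> ennreal E * (\<Sum>j\<le>p. g (b j + (s j / 2) *\<^sub>R y))" for y
    proof (cases "y \<in> W")
      case True
      obtain q where q: "degree q \<le> p" "\<And>t. v (x + t *\<^sub>R ((1/2) *\<^sub>R (a + y) - x)) = poly q t"
        using polynomials_upto_on_line[OF v] by blast
      have "(v x)\<^sup>2 \<le> E * (\<Sum>j\<le>p. (v (b j + (s j / 2) *\<^sub>R y))\<^sup>2)"
        using ext[OF q(1)] unfolding q(2)[symmetric] unfolding b_def shift by simp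
      then have "ennreal ((v x)\<^sup>2) \<le> ennreal E * (\<Sum>j\<le>p. ennreal ((v (b j + (s j / 2) *\<^sub>R y))\<^sup>2))"
        using E by (simp add: ennreal_mult[symmetric] sum_nonneg ennreal_leI)
      moreover have "b j + (s j / 2) *\<^sub>R y \<in> W" if "j \<le> p" for j
        using star True s[OF that] shift[of "s j" y] unfolding b_def by metis
      ultimately show ?thesis using True by (simp add: g_def)
    qed simp
    have int: "(\<integral>\<^sup>+ y. g (b j + (s j / 2) *\<^sub>R y) \<partial>lborel) \<le> ennreal B * I" if "j \<le> p" for j
    proof -
      have sj: "\<rho> \<le> s j" "s j \<le> 1" using s[OF that] by auto
      have "(\<rho> / 2) ^ CARD('n) \<le> \<bar>s j / 2\<bar> ^ CARD('n)" using sj \<rho> by (intro power_mono) auto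
      then have "1 \<le> B * \<bar>s j / 2\<bar> ^ CARD('n)"
        using \<rho> by (simp add: B_def field_simps power_divide)
      then have "1 * (\<integral>\<^sup>+ y. g (b j + (s j / 2) *\<^sub>R y) \<partial>lborel)
          \<le> ennreal (B * \<bar>s j / 2\<bar> ^ CARD('n)) * (\<integral>\<^sup>+ y. g (b j + (s j / 2) *\<^sub>R y) \<partial>lborel)"
        by (intro mult_right_mono) (auto simp: ennreal_ge_1)
      also have "\<dots> = ennreal B * I"
        unfolding I_def using sj \<rho> B
        by (subst nn_integral_lborel_affine[of g "s j / 2" "b j"]) (auto simp: ennreal_mult mult.assoc)
      finally show ?thesis by simp
    qed
    have "ennreal ((v x)\<^sup>2) * emeasure lborel W = (\<integral>\<^sup>+ y. ennreal ((v x)\<^sup>2) * indicator W y \<partial>lborel)"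
      by (simp add: nn_integral_cmult_indicator)
    also have "\<dots> \<le> (\<integral>\<^sup>+ y. ennreal E * (\<Sum>j\<le>p. g (b j + (s j / 2) *\<^sub>R y)) \<partial>lborel)"
      by (intro nn_integral_mono pw)
    also have "\<dots> = ennreal E * (\<Sum>j\<le>p. \<integral>\<^sup>+ y. g (b j + (s j / 2) *\<^sub>R y) \<partial>lborel)"
      by (subst nn_integral_cmult) (auto simp: nn_integral_sum)
    also have "\<dots> \<le> ennreal E * (\<Sum>j\<le>p. ennreal B * I)"
      by (intro mult_left_mono sum_mono int) auto
    also have "\<dots> = ennreal M * I"
      unfolding M_def using E B by (simp add: ennreal_mult mult.assoc[symmetric] flip: ennreal_of_nat_eq_real_of_nat)
    finally show ?thesis unfolding I_def g_def .
  qed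
  moreover have "M > 0" using E B by (simp add: M_def)
  ultimately show ?thesis by blast
qed

section \<open>Slabs and caps of convex bodies\<close>

lemma prod_inner_Basis_cart: "(\<Prod>b\<in>Basis. x \<bullet> b) = (\<Prod>i\<in>UNIV. (x :: real^'n) $ i)"
  by (simp add: Basis_vec_def cart_eq_inner_axis axis_eq_axis prod.UNION_disjoint)

text \<open>
  Volumes survive a bijective renaming of the coordinates. This carries the slab estimate, whose
  proof by rotation orders the coordinates, over to index types without an order.
\<close>

lemma lborel_relabel_coordinates:
  fixes \<sigma> :: "'m::finite \<Rightarrow> 'n::finite"
  assumes \<sigma>: "bij \<sigma>"
  shows "(lborel :: (real^'n) measure) = distr lborel borel (\<lambda>y. \<chi> j. (y :: real^'m) $ inv \<sigma> j)"
proof (rule lborel_eqI)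
  fix l u :: "real^'n" assume le: "\<And>b. b \<in> Basis \<Longrightarrow> l \<bullet> b \<le> u \<bullet> b"
  define P where "P x = (\<chi> i. (x :: real^'n) $ \<sigma> i)" for x
  define Q where "Q y = (\<chi> j. (y :: real^'m) $ inv \<sigma> j)" for y
  have Q[measurable]: "Q \<in> borel \<rightarrow>\<^sub>M borel"
    unfolding Q_def[abs_def] by (intro borel_measurable_continuous_onI continuous_intros)
  have lu: "l $ j \<le> u $ j" for j
    using le[of "axis j 1"] by (simp add: inner_axis axis_in_Basis_iff)
  have "Q -` box l u = box (P l) (P u)"
  proof -
    have "(\<forall>j. l $ j < y $ inv \<sigma> j \<and> y $ inv \<sigma> j < u $ j) \<longleftrightarrow> (\<forall>i. l $ \<sigma> i < y $ i \<and> y $ i < u $ \<sigma> i)" for y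
      using \<sigma> by (metis bij_inv_eq_iff)
    then show ?thesis by (auto simp: P_def Q_def mem_box_cart)
  qed
  then have "emeasure (distr lborel borel Q) (box l u) = emeasure lborel (box (P l) (P u))"
    by (simp add: emeasure_distr)
  also have "\<dots> = (\<Prod>b\<in>Basis. (P u - P l) \<bullet> b)"
    by (rule emeasure_lborel_box) (auto simp: Basis_vec_def P_def inner_axis lu)
  also have "\<dots> = (\<Prod>i\<in>UNIV. (u - l) $ \<sigma> i)"
    by (simp add: prod_inner_Basis_cart P_def)
  also have "\<dots> = (\<Prod>j\<in>UNIV. (u - l) $ j)"
    by (rule arg_cong[OF prod.reindex_bij_betw[OF \<sigma>]])
  finally show "emeasure (distr lborel borel Q) (box l u) = (\<Prod>b\<in>Basis. (u - l) \<bullet> b)"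
    by (simp add: prod_inner_Basis_cart)
qed simp

text \<open>
  Rotating the normal of the slab onto a coordinate axis puts the set into a box with one edge \<open>w\<close> and
  all others \<open>h\<close>. The constant is exactly \<open>1\<close>, which matters: the strip around the interface has to lose
  against a threshold in which the factor \<open>2\<close> is all the room there is.
\<close>

lemma measure_slab_le_wellorder:
  fixes S :: "(real^'n::{finite,wellorder}) set"
  assumes S: "S \<in> sets lborel" "bounded S" and n: "norm n = 1"
    and slab: "S \<subseteq> {x. t \<le> n \<bullet> x \<and> n \<bullet> x \<le> t + w}"
    and h: "diameter S \<le> h"
  shows "measure lborel S \<le> \<bar>w\<bar> * h ^ (CARD('n) - 1)"
proof (cases "S = {}")
  case True
  have "0 \<le> h" using h True by simp
  with True show ?thesis by simp
next
  case False
  fix k :: 'n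
  have "0 \<le> diameter S" using S by (intro diameter_ge_0)
  with h have h0: "0 \<le> h" by simp
  have "norm (axis k 1 :: (real, 'n) vec) = 1" by (simp add: norm_axis_1)
  then obtain f where f: "orthogonal_transformation f" "f n = axis k (1::real)"
    using orthogonal_transformation_exists_1[OF n] by metis
  have fk: "f x $ k = n \<bullet> x" for x
  proof -
    have "f x $ k = f n \<bullet> f x" unfolding f(2) by (simp add: inner_axis')
    then show ?thesis using f(1) by (simp add: orthogonal_transformation_def)
  qed
  have w0: "0 \<le> w" using slab False by force
  have close: "f x $ j - h \<le> f y $ j" if "x \<in> S" "y \<in> S" for x y j
  proof -
    have "\<bar>f x $ j - f y $ j\<bar> \<le> norm (f x - f y)"
      using component_le_norm_cart[of "f x - f y" j] by simp
    also have "\<dots> = dist x y"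
      by (simp add: dist_norm f(1) orthogonal_transformation_norm
          flip: linear_diff[OF orthogonal_transformation_linear[OF f(1)]])
    also have "\<dots> \<le> h" using diameter_bounded_bound[OF S(2) that] h by simp
    finally show ?thesis by simp
  qed
  obtain x0 where x0: "x0 \<in> S" using False by auto
  define lo :: "(real, 'n) vec" where "lo = (\<chi> j. if j = k then t else Inf ((\<lambda>x. f x $ j) ` S))"
  define hi :: "(real, 'n) vec" where "hi = (\<chi> j. lo $ j + (if j = k then w else h))"
  have "f ` S \<subseteq> cbox lo hi"
  proof (clarsimp simp: mem_box_cart)
    fix x j assume x: "x \<in> S"
    have "bdd_below ((\<lambda>x. f x $ j) ` S)"
      using close[OF x0] by (intro bdd_belowI2[of _ "f x0 $ j - h"])
    then have "Inf ((\<lambda>x. f x $ j) ` S) \<le> f x $ j" using x by (intro cINF_lower)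
    moreover have "f x $ j - h \<le> Inf ((\<lambda>x. f x $ j) ` S)"
      using False close[OF x] by (intro cINF_greatest)
    moreover have "t \<le> f x $ k" "f x $ k \<le> t + w" using slab x by (auto simp: fk)
    ultimately show "lo $ j \<le> f x $ j \<and> f x $ j \<le> hi $ j"
      by (auto simp: lo_def hi_def)
  qed
  moreover have S': "S \<in> lmeasurable"
    using S by (simp add: bounded_set_imp_lmeasurable)
  ultimately have "measure lebesgue (f ` S) \<le> measure lebesgue (cbox lo hi)"
    using measurable_orthogonal_image[OF f(1) S'] by (intro measure_mono_fmeasurable) auto
  moreover have "measure lebesgue (f ` S) = measure lborel S"
    using measure_orthogonal_image[OF f(1) S'] S(1) by (simp add: measure_completion)
  moreover have "measure lebesgue (cbox lo hi) = w * h ^ (CARD('n) - 1)"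
  proof -
    have "cbox lo hi \<noteq> {}" using h0 w0 by (auto simp: interval_ne_empty_cart hi_def)
    then have "measure lebesgue (cbox lo hi) = (\<Prod>j\<in>UNIV. if j = k then w else h)"
      by (simp add: content_cbox_cart hi_def cong: if_cong)
    also have "\<dots> = w * (\<Prod>j\<in>UNIV - {k}. h)"
      by (subst prod.remove[of UNIV k]) (auto intro!: prod.cong)
    finally show ?thesis by (simp add: card_Diff_singleton)
  qed
  ultimately show ?thesis using w0 by simp
qed

lemma measure_slab_le_same_card:
  fixes S :: "(real^'n::finite) set"
  assumes card: "CARD('m::{finite,wellorder}) = CARD('n)"
    and S: "S \<in> sets lborel" "bounded S" and n: "norm n = 1"
    and slab: "S \<subseteq> {x. t \<le> n \<bullet> x \<and> n \<bullet> x \<le> t + w}"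
    and h: "diameter S \<le> h"
  shows "measure lborel S \<le> \<bar>w\<bar> * h ^ (CARD('n) - 1)"
proof -
  obtain \<sigma> :: "'m \<Rightarrow> 'n" where \<sigma>: "bij \<sigma>"
    using finite_same_card_bij[OF finite finite card] by auto
  define P where "P x = (\<chi> i. (x :: real^'n) $ \<sigma> i)" for x
  define Q where "Q y = (\<chi> j. (y :: (real, 'm) vec) $ inv \<sigma> j)" for y
  have QP: "Q (P x) = x" and PQ: "P (Q y) = y" for x y
    using \<sigma> by (simp_all add: P_def Q_def vec_eq_iff bij_is_surj surj_f_inv_f bij_is_inj)
  have inner_P: "P x \<bullet> P y = x \<bullet> y" for x y
    unfolding inner_vec_def P_def by (simp add: sum.reindex_bij_betw[OF \<sigma>, of "\<lambda>j. x $ j * y $ j"])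
  have norm_P: "norm (P x) = norm x" for x by (simp add: norm_eq_sqrt_inner inner_P)
  have dist_P: "dist (P x) (P y) = dist x y" for x y
  proof -
    have "P x - P y = P (x - y)" by (simp add: P_def vec_eq_iff)
    then show ?thesis by (simp add: dist_norm norm_P)
  qed
  have image: "P ` S = Q -` S"
  proof
    show "P ` S \<subseteq> Q -` S" by (auto simp: QP)
    show "Q -` S \<subseteq> P ` S" using PQ by (auto intro: image_eqI[of _ P "Q _"])
  qed
  have Q[measurable]: "Q \<in> borel \<rightarrow>\<^sub>M borel"
    unfolding Q_def[abs_def] by (intro borel_measurable_continuous_onI continuous_intros)
  have "measure lborel S = measure lborel (P ` S)"
    using S(1) unfolding image lborel_relabel_coordinates[OF \<sigma>]
    by (subst measure_distr) (auto simp: Q_def[abs_def, symmetric])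
  also have "\<dots> \<le> \<bar>w\<bar> * h ^ (CARD('m) - 1)"
  proof (rule measure_slab_le_wellorder)
    show "P ` S \<in> sets lborel"
      using measurable_sets[OF Q, of S] S(1) by (simp add: image)
    show "bounded (P ` S)"
      using S(2) by (simp add: bounded_iff norm_P)
    show "norm (P n) = 1" by (simp add: norm_P n)
    show "P ` S \<subseteq> {x. t \<le> P n \<bullet> x \<and> P n \<bullet> x \<le> t + w}"
      using slab by (auto simp: inner_P)
    have "0 \<le> h" using diameter_ge_0[OF S(2)] h by simp
    moreover have "norm (P x - P y) \<le> h" if "x \<in> S" "y \<in> S" for x y
      using diameter_bounded_bound[OF S(2) that] h by (simp add: dist_P flip: dist_norm)
    ultimately show "diameter (P ` S) \<le> h" by (intro diameter_le) auto
  qed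
  finally show ?thesis by (simp add: card)
qed

lemma measure_slab_le:
  fixes S :: "(real^'n) set"
  assumes dim: "CARD('n) = 2 \<or> CARD('n) = 3"
    and S: "S \<in> sets lborel" "bounded S" and n: "norm n = 1"
    and slab: "S \<subseteq> {x. t \<le> n \<bullet> x \<and> n \<bullet> x \<le> t + w}"
    and h: "diameter S \<le> h"
  shows "measure lborel S \<le> \<bar>w\<bar> * h ^ (CARD('n) - 1)"
  using dim measure_slab_le_same_card[OF _ S n slab h, where 'm = 2]
    measure_slab_le_same_card[OF _ S n slab h, where 'm = 3] by auto

text \<open>
  Only interior points of \<open>K\<close> are taken, so that a cap is open and cannot touch the boundary of the
  domain.
\<close>

definition cap :: "(real^'n) set \<Rightarrow> real^'n \<Rightarrow> real \<Rightarrow> (real^'n) set" where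
  "cap K n t = {y \<in> interior K. t < n \<bullet> y}"

lemma open_cap: "open (cap K n t)"
proof -
  have "cap K n t = interior K \<inter> {y. t < n \<bullet> y}" by (auto simp: cap_def)
  then show ?thesis by (simp add: open_Int open_halfspace_gt)
qed

lemma convex_cap:
  assumes "convex K" shows "convex (cap K n t)"
proof -
  have "cap K n t = interior K \<inter> {y. n \<bullet> y > t}" by (auto simp: cap_def)
  then show ?thesis using assms by (simp add: convex_Int convex_interior convex_halfspace_gt)
qed

text \<open>
  The part of \<open>K\<close> above level \<open>t + \<delta>\<close> bounds \<open>v\<close> also in the layer of thickness \<open>\<delta>\<close> below it. The volume
  hypothesis forces the cap to reach a height of at least \<open>\<delta> / 2\<close> above the layer, since a cap of height
  \<open>H\<close> has volume at most \<open>H h\<^sup>d\<^sup>-\<^sup>1\<close>. Taking for \<open>a\<close> a highest point of \<open>K\<close>, the midpoint of \<open>a\<close> and a point of the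
  cap is then at height at least \<open>t + 5/4 \<delta>\<close>, and a segment from a point above level \<open>t\<close> to this midpoint has its
  last fifth inside the cap. So the previous estimate applies with \<open>\<rho> = 4/5\<close>.
\<close>

lemma pointwise_bound_by_L2_on_cap:
  assumes dim: "CARD('n) = 2 \<or> CARD('n) = 3"
  shows "\<exists>M>0. \<forall>v\<in>polynomials_upto p. \<forall>K n t \<delta>. \<forall>x::real^'n.
    compact K \<longrightarrow> convex K \<longrightarrow> 0 < diameter K \<longrightarrow> norm n = 1 \<longrightarrow> 0 \<le> \<delta> \<longrightarrow>
    \<delta> / 2 * diameter K ^ (CARD('n) - 1) \<le> measure lborel (cap K n (t + \<delta>)) \<longrightarrow>
    x \<in> K \<longrightarrow> t \<le> n \<bullet> x \<longrightarrow>
    ennreal ((v x)\<^sup>2) * emeasure lborel (cap K n (t + \<delta>))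
      \<le> ennreal M * (\<integral>\<^sup>+ y. ennreal ((v y)\<^sup>2) * indicator (cap K n (t + \<delta>)) y \<partial>lborel)"
proof -
  obtain M where M: "M > 0" and star: "\<forall>v\<in>polynomials_upto p. \<forall>W (x :: real^'n) a.
    W \<in> sets borel \<longrightarrow> (\<forall>y\<in>W. \<forall>s\<in>{4/5..1}. x + s *\<^sub>R ((1/2) *\<^sub>R (a + y) - x) \<in> W) \<longrightarrow>
    ennreal ((v x)\<^sup>2) * emeasure lborel W
      \<le> ennreal M * (\<integral>\<^sup>+ y. ennreal ((v y)\<^sup>2) * indicator W y \<partial>lborel)"
    using pointwise_bound_by_L2_on_star[of "4/5" p, where 'n='n] by auto
  have "ennreal ((v x)\<^sup>2) * emeasure lborel (cap K n (t + \<delta>))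
      \<le> ennreal M * (\<integral>\<^sup>+ y. ennreal ((v y)\<^sup>2) * indicator (cap K n (t + \<delta>)) y \<partial>lborel)"
    if v: "v \<in> polynomials_upto p" and K: "compact K" "convex K" "0 < diameter K"
      and n: "norm n = 1" and \<delta>: "0 \<le> \<delta>"
      and big: "\<delta> / 2 * diameter K ^ (CARD('n) - 1) \<le> measure lborel (cap K n (t + \<delta>))"
      and x: "x \<in> K" "t \<le> n \<bullet> x"
    for v :: "real^'n \<Rightarrow> real" and K n t \<delta> x
  proof (cases "cap K n (t + \<delta>) = {}")
    case False
    \<comment> \<open>a highest point of \<open>K\<close>, and the height of the cap\<close>
    obtain a where a: "a \<in> K" "\<And>y. y \<in> K \<Longrightarrow> n \<bullet> y \<le> n \<bullet> a"
      using continuous_attains_sup[of K "\<lambda>y. n \<bullet> y", OF K(1) _ continuous_on_inner[OF continuous_on_const continuous_on_id]] x(1)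
      by auto
    define H where "H = n \<bullet> a - (t + \<delta>)"
    have capK: "cap K n (t + \<delta>) \<subseteq> K" using interior_subset by (auto simp: cap_def)
    have bK: "bounded K" using K(1) by (rule compact_imp_bounded)
    have H0: "0 < H" using False a(2) capK by (force simp: cap_def H_def)
    have "measure lborel (cap K n (t + \<delta>)) \<le> \<bar>H\<bar> * diameter K ^ (CARD('n) - 1)"
    proof (rule measure_slab_le[OF dim _ _ n, of _ "t + \<delta>"])
      show "cap K n (t + \<delta>) \<subseteq> {y. t + \<delta> \<le> n \<bullet> y \<and> n \<bullet> y \<le> t + \<delta> + H}"
        using a(2) capK by (auto simp: cap_def H_def)
      show "diameter (cap K n (t + \<delta>)) \<le> diameter K" by (rule diameter_subset[OF capK bK])
    qed (use capK bK in \<open>auto simp: open_cap intro: bounded_subset\<close>)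
    with big have "\<delta> / 2 * diameter K ^ (CARD('n) - 1) \<le> H * diameter K ^ (CARD('n) - 1)"
      using H0 by simp
    then have H: "\<delta> / 2 \<le> H" by (rule mult_right_le_imp_le) (use K(3) in simp)
    show ?thesis
    proof (rule star[rule_format, OF v, of _ _ a])
      fix y s assume y: "y \<in> cap K n (t + \<delta>)" and s: "s \<in> {4/5..1::real}"
      define z where "z = (1/2) *\<^sub>R (a + y)"
      have "a - (1/2) *\<^sub>R (a - y) \<in> interior K"
        by (rule mem_interior_convex_shrink) (use K a y in \<open>auto simp: cap_def\<close>)
      also have "a - (1/2) *\<^sub>R (a - y) = z" by (simp add: z_def vec_eq_iff field_simps)
      finally have z: "z \<in> interior K" .
      have "x - s *\<^sub>R (x - z) \<in> interior K"
        by (rule mem_interior_convex_shrink) (use K x z s in auto)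
      moreover have "x - s *\<^sub>R (x - z) = x + s *\<^sub>R (z - x)" by (simp add: algebra_simps)
      ultimately have "x + s *\<^sub>R (z - x) \<in> interior K" by metis
      moreover have "t + \<delta> < n \<bullet> (x + s *\<^sub>R (z - x))"
      proof -
        have "n \<bullet> z = (n \<bullet> a + n \<bullet> y) / 2" by (simp add: z_def inner_add_right)
        moreover have "t + \<delta> < n \<bullet> y" using y by (simp add: cap_def)
        ultimately have nz: "t + 5/4 * \<delta> < n \<bullet> z" using H unfolding H_def by (simp add: field_simps)
        have "t + \<delta> \<le> (1 - s) * t + s * (t + 5/4 * \<delta>)"
        proof -
          have "1 * \<delta> \<le> (s * (5/4)) * \<delta>" using \<delta> s by (intro mult_right_mono) auto
          then show ?thesis by (simp add: algebra_simps)
        qed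
        also have "\<dots> < (1 - s) * (n \<bullet> x) + s * (n \<bullet> z)"
          using nz x(2) s by (intro add_le_less_mono mult_left_mono mult_strict_left_mono) auto
        also have "\<dots> = n \<bullet> (x + s *\<^sub>R (z - x))"
          by (simp add: inner_add_right inner_diff_right algebra_simps)
        finally show ?thesis .
      qed
      ultimately show "x + s *\<^sub>R ((1/2) *\<^sub>R (a + y) - x) \<in> cap K n (t + \<delta>)"
        by (simp add: cap_def z_def)
    qed (simp add: open_cap borel_open)
  qed simp
  with M show ?thesis by blast
qed

section \<open>The area of small pieces of a smooth hypersurface\<close>

lemma hausdorff_pre_le_finite_cover:
  fixes A :: "'a::metric_space set"
  assumes F: "finite F" and cover: "A \<subseteq> (\<Union>m\<in>F. U m)"
    and U: "\<And>m. m \<in> F \<Longrightarrow> bounded (U m)" "\<And>m. m \<in> F \<Longrightarrow> diameter (U m) \<le> \<rho>"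
    and \<rho>: "0 \<le> \<rho>" "\<rho> \<le> \<delta>"
  shows "hausdorff_pre s \<delta> A \<le> ennreal (real (card F) * (unit_ball_vol (real s) * (\<rho> / 2) ^ s))"
proof -
  obtain e where e: "bij_betw e {..<card F} F"
    using ex_bij_betw_nat_finite[OF F] by (auto simp: atLeast0LessThan)
  define V where "V i = (if i < card F then U (e i) else {})" for i
  have eF: "e i \<in> F" if "i < card F" for i using e that by (auto simp: bij_betw_def)
  have "hausdorff_pre s \<delta> A \<le> (\<Sum>i. hausdorff_cost s (V i))"
  proof (rule hausdorff_pre_le)
    show "A \<subseteq> (\<Union>i. V i)"
    proof
      fix x assume "x \<in> A"
      then obtain m where m: "m \<in> F" "x \<in> U m" using cover by auto
      then obtain i where "i < card F" "m = e i" using e unfolding bij_betw_def by blast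
      then have "x \<in> V i" using m by (simp add: V_def)
      then show "x \<in> (\<Union>i. V i)" by blast
    qed
    show "bounded (V i)" "diameter (V i) \<le> \<delta>" for i
      using U[OF eF, of i] \<rho> by (auto simp: V_def)
  qed
  also have "\<dots> = (\<Sum>i<card F. hausdorff_cost s (V i))"
    by (rule suminf_finite) (auto simp: V_def hausdorff_cost_def)
  also have "\<dots> \<le> (\<Sum>i<card F. ennreal (unit_ball_vol (real s) * (\<rho> / 2) ^ s))"
  proof (rule sum_mono)
    fix i assume "i \<in> {..<card F}"
    then have i: "i < card F" by simp
    have "(diameter (U (e i)) / 2) ^ s \<le> (\<rho> / 2) ^ s"
      using U[OF eF[OF i]] diameter_ge_0 by (intro power_mono) auto
    then show "hausdorff_cost s (V i) \<le> ennreal (unit_ball_vol (real s) * (\<rho> / 2) ^ s)"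
      using i by (auto simp: hausdorff_cost_def V_def intro!: ennreal_leI mult_left_mono)
  qed
  also have "\<dots> = ennreal (real (card F) * (unit_ball_vol (real s) * (\<rho> / 2) ^ s))"
    using \<rho> by (simp add: ennreal_mult ennreal_of_nat_eq_real_of_nat)
  finally show ?thesis .
qed

text \<open>
  A set that is a Lipschitz graph over a coordinate hyperplane is covered by \<open>(N + 1)\<^sup>d\<^sup>-\<^sup>1\<close> pieces of
  diameter \<open>O(h / N)\<close>, namely the parts above the cells of a grid in that hyperplane. The total cost stays
  bounded by a multiple of \<open>h\<^sup>d\<^sup>-\<^sup>1\<close> as \<open>N\<close> grows.
\<close>

lemma hausdorff_outer_lipschitz_graph_le:
  fixes S :: "(real^'n) set"
  assumes S: "bounded S" "diameter S \<le> h" and h: "0 < h" and L: "0 \<le> L"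
    and graph: "\<And>y z. y \<in> S \<Longrightarrow> z \<in> S \<Longrightarrow> dist y z \<le> L * (\<Sum>j\<in>- {k}. \<bar>y $ j - z $ j\<bar>)"
  shows "hausdorff_outer (CARD('n) - 1) S
    \<le> ennreal (unit_ball_vol (real (CARD('n) - 1)) * (L * real CARD('n) * h) ^ (CARD('n) - 1))"
  unfolding hausdorff_outer_def
proof (rule SUP_least)
  define s where "s = CARD('n) - 1"
  fix \<delta> :: real assume "\<delta> \<in> {0<..}"
  then have \<delta>: "0 < \<delta>" by simp
  obtain N :: nat where N: "L * real CARD('n) * h / \<delta> < real N" "0 < N"
  proof -
    obtain N :: nat where "L * real CARD('n) * h / \<delta> < real N" using reals_Archimedean2 by blast
    then show ?thesis by (intro that[of "Suc N"]) auto
  qed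
  define \<rho> where "\<rho> = L * real CARD('n) * h / real N"
  have \<rho>: "0 \<le> \<rho>" "\<rho> \<le> \<delta>" using L h \<delta> N by (auto simp: \<rho>_def field_simps)
  define lo where "lo j = Inf ((\<lambda>x. x $ j) ` S)" for j
  \<comment> \<open>points with coordinate exactly \<open>lo j + h\<close> fall into a cell of their own, hence \<open>N + 1\<close> cells per direction\<close>
  define cell where "cell y = (\<lambda>j\<in>- {k}. nat \<lfloor>(y $ j - lo j) * (real N / h)\<rfloor>)" for y :: "real^'n"
  define F where "F = (- {k}) \<rightarrow>\<^sub>E {..N}"
  define U where "U m = {y \<in> S. cell y = m}" for m
  have range: "0 \<le> (y $ j - lo j) * (real N / h)" "(y $ j - lo j) * (real N / h) \<le> real N"
    if y: "y \<in> S" for y j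
  proof -
    have close: "y $ j - h \<le> z $ j" if "z \<in> S" "y \<in> S" for y z
      using component_le_norm_cart[of "y - z" j] diameter_bounded_bound[OF S(1) that(2,1)] S(2)
      by (simp add: dist_norm)
    have "bdd_below ((\<lambda>x. x $ j) ` S)"
      using close[OF _ y] by (intro bdd_belowI2[of _ "y $ j - h"])
    then have "lo j \<le> y $ j" unfolding lo_def using y by (intro cINF_lower)
    then show "0 \<le> (y $ j - lo j) * (real N / h)" using h by simp
    have "y $ j - h \<le> lo j" unfolding lo_def using y close by (intro cINF_greatest) auto
    then have "(y $ j - lo j) * (real N / h) \<le> h * (real N / h)" using h by (intro mult_right_mono) auto
    then show "(y $ j - lo j) * (real N / h) \<le> real N" using h by simp
  qed
  have "hausdorff_pre s \<delta> S \<le> ennreal (real (card F) * (unit_ball_vol (real s) * (\<rho> / 2) ^ s))"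
  proof (rule hausdorff_pre_le_finite_cover[OF _ _ _ _ \<rho>])
    show "finite F" unfolding F_def by (intro finite_PiE) auto
    have "cell y \<in> F" if "y \<in> S" for y
    proof -
      have "nat \<lfloor>(y $ j - lo j) * (real N / h)\<rfloor> \<le> N" for j
        using range[OF that, of j] by linarith
      then show ?thesis by (auto simp: cell_def F_def)
    qed
    then show "S \<subseteq> (\<Union>m\<in>F. U m)" by (auto simp: U_def)
    show "bounded (U m)" for m using S(1) by (rule bounded_subset) (auto simp: U_def)
    show "diameter (U m) \<le> \<rho>" for m
    proof (rule diameter_le)
      fix y z assume "y \<in> U m" "z \<in> U m"
      then have yz: "y \<in> S" "z \<in> S" "cell y = cell z" by (auto simp: U_def)
      have "\<bar>y $ j - z $ j\<bar> \<le> h / real N" if "j \<in> - {k}" for j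
      proof -
        define a b where "a = (y $ j - lo j) * (real N / h)" and "b = (z $ j - lo j) * (real N / h)"
        have "nat \<lfloor>a\<rfloor> = nat \<lfloor>b\<rfloor>"
          using fun_cong[OF yz(3), of j] that by (simp add: cell_def a_def b_def)
        moreover have "0 \<le> a" "0 \<le> b" using range(1) yz(1,2) by (auto simp: a_def b_def)
        ultimately have "\<lfloor>a\<rfloor> = \<lfloor>b\<rfloor>" by (simp add: nat_eq_iff)
        then have "\<bar>a - b\<bar> \<le> 1" by linarith
        then have "\<bar>a - b\<bar> * (h / real N) \<le> 1 * (h / real N)"
          using h by (intro mult_right_mono) auto
        moreover have "\<bar>a - b\<bar> * (h / real N) = \<bar>(a - b) * (h / real N)\<bar>"
          using h unfolding abs_mult by simp
        moreover have "(a - b) * (h / real N) = y $ j - z $ j"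
          using h N(2) by (simp add: a_def b_def field_simps)
        ultimately show ?thesis by (metis mult_1)
      qed
      then have "(\<Sum>j\<in>- {k}. \<bar>y $ j - z $ j\<bar>) \<le> (\<Sum>j\<in>- {k}. h / real N)" by (rule sum_mono)
      also have "\<dots> \<le> (\<Sum>j\<in>(UNIV :: 'n set). h / real N)" using h by (intro sum_mono2) auto
      finally have "L * (\<Sum>j\<in>- {k}. \<bar>y $ j - z $ j\<bar>) \<le> L * (real CARD('n) * (h / real N))"
        using L by (intro mult_left_mono) auto
      then show "norm (y - z) \<le> \<rho>"
        using graph[OF yz(1,2)] by (simp add: dist_norm \<rho>_def mult.assoc)
    qed (use \<rho> in simp)
  qed
  also have "\<dots> \<le> ennreal (unit_ball_vol (real s) * (L * real CARD('n) * h) ^ s)"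
  proof (rule ennreal_leI)
    have "card F = (N + 1) ^ s"
      unfolding F_def s_def by (subst card_PiE) (auto simp: Compl_eq_Diff_UNIV card_Diff_singleton)
    then have "real (card F) * (\<rho> / 2) ^ s = (real (N + 1) * (\<rho> / 2)) ^ s"
      by (simp only: power_mult_distrib of_nat_power)
    also have "\<dots> \<le> (L * real CARD('n) * h) ^ s"
    proof (rule power_mono)
      have "real (N + 1) * (\<rho> / 2) \<le> (2 * real N) * (\<rho> / 2)"
        using N(2) \<rho>(1) by (intro mult_right_mono) auto
      also have "\<dots> = L * real CARD('n) * h" using N(2) by (simp add: \<rho>_def)
      finally show "real (N + 1) * (\<rho> / 2) \<le> L * real CARD('n) * h" .
    qed (use \<rho> in simp)
    finally have "unit_ball_vol (real s) * (real (card F) * (\<rho> / 2) ^ s)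
        \<le> unit_ball_vol (real s) * (L * real CARD('n) * h) ^ s"
      by (intro mult_left_mono) auto
    then show "real (card F) * (unit_ball_vol (real s) * (\<rho> / 2) ^ s)
        \<le> unit_ball_vol (real s) * (L * real CARD('n) * h) ^ s" by (simp add: mult_ac)
  qed
  finally show "hausdorff_pre (CARD('n) - 1) \<delta> S
      \<le> ennreal (unit_ball_vol (real (CARD('n) - 1)) * (L * real CARD('n) * h) ^ (CARD('n) - 1))"
    by (simp add: s_def)
qed

text \<open>
  Near \<open>x\<close> the gradient of a defining function \<open>\<phi>\<close> is almost constant, so for two points of the surface
  the increment \<open>w\<close> is almost orthogonal to the gradient \<open>G x\<close>. Solving for the coordinate \<open>k\<close> in which
  \<open>G x\<close> is largest expresses \<open>w\<^sub>k\<close> through the other coordinates with a constant that depends neither on the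
  surface nor on the dimension.
\<close>

lemma C2_hypersurface_locally_lipschitz_graph:
  fixes \<Gamma> :: "(real^'n) set"
  assumes "C2_hypersurface \<Gamma>" "x \<in> \<Gamma>"
  shows "\<exists>\<epsilon>>0. \<exists>k. \<forall>y\<in>\<Gamma> \<inter> ball x \<epsilon>. \<forall>z\<in>\<Gamma> \<inter> ball x \<epsilon>. dist y z \<le> 4 * (\<Sum>j\<in>- {k}. \<bar>y $ j - z $ j\<bar>)"
proof -
  have "\<exists>U \<phi> (G :: real^'n \<Rightarrow> real^'n) (H :: real^'n \<Rightarrow> real^'n^'n).
        open U \<and> x \<in> U \<and>
        (\<forall>y\<in>U. (\<phi> has_derivative (\<lambda>v. G y \<bullet> v)) (at y)) \<and>
        (\<forall>y\<in>U. (G has_derivative (\<lambda>v. H y *v v)) (at y)) \<and>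
        continuous_on U H \<and> (\<forall>y\<in>U. G y \<noteq> 0) \<and> \<Gamma> \<inter> U = {y\<in>U. \<phi> y = 0}"
    using assms(1) unfolding C2_hypersurface_def by (rule bspec[OF _ assms(2)])
  then obtain U \<phi> and G :: "real^'n \<Rightarrow> real^'n" and H :: "real^'n \<Rightarrow> real^'n^'n" where *:
    "open U \<and> x \<in> U \<and>
        (\<forall>y\<in>U. (\<phi> has_derivative (\<lambda>v. G y \<bullet> v)) (at y)) \<and>
        (\<forall>y\<in>U. (G has_derivative (\<lambda>v. H y *v v)) (at y)) \<and>
        continuous_on U H \<and> (\<forall>y\<in>U. G y \<noteq> 0) \<and> \<Gamma> \<inter> U = {y\<in>U. \<phi> y = 0}"
    by (elim exE) (rule that)
  then have U: "open U" "x \<in> U" and level: "\<Gamma> \<inter> U = {y\<in>U. \<phi> y = 0}" by simp_all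
  have \<phi>: "(\<phi> has_derivative (\<lambda>v. G y \<bullet> v)) (at y)"
    and G: "(G has_derivative (\<lambda>v. H y *v v)) (at y)" and G0: "G y \<noteq> 0" if "y \<in> U" for y
    using * that by simp_all
  obtain k where k: "\<And>j. \<bar>G x $ j\<bar> \<le> \<bar>G x $ k\<bar>"
  proof -
    have "finite (range (\<lambda>j. \<bar>G x $ j\<bar>))" "range (\<lambda>j. \<bar>G x $ j\<bar>) \<noteq> {}" by auto
    then have "Max (range (\<lambda>j. \<bar>G x $ j\<bar>)) \<in> range (\<lambda>j. \<bar>G x $ j\<bar>)" by (rule Max_in)
    then obtain k where k: "Max (range (\<lambda>j. \<bar>G x $ j\<bar>)) = \<bar>G x $ k\<bar>" by blast
    have "\<bar>G x $ j\<bar> \<le> Max (range (\<lambda>j. \<bar>G x $ j\<bar>))" for j by (rule Max_ge) auto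
    then show ?thesis unfolding k by (rule that)
  qed
  define g where "g = \<bar>G x $ k\<bar>"
  have g: "0 < g"
  proof (rule ccontr)
    assume "\<not> 0 < g"
    then have "G x $ j = 0" for j using k[of j] by (auto simp: g_def)
    then show False using G0[OF U(2)] by (simp add: vec_eq_iff)
  qed
  have "isCont G x" using G[OF U(2)] by (rule has_derivative_continuous)
  then obtain \<epsilon>1 where \<epsilon>1: "0 < \<epsilon>1" "\<And>y. dist y x < \<epsilon>1 \<Longrightarrow> dist (G y) (G x) < g / 2"
    using continuous_at_eps_delta[THEN iffD1, rule_format, of x G "g / 2"] g by auto
  obtain \<epsilon>2 where \<epsilon>2: "0 < \<epsilon>2" "ball x \<epsilon>2 \<subseteq> U" using U openE by blast
  define \<epsilon> where "\<epsilon> = min \<epsilon>1 \<epsilon>2"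
  have ball: "y \<in> U" "norm (G y - G x) \<le> g / 2" if "y \<in> ball x \<epsilon>" for y
  proof -
    have "dist y x < \<epsilon>1" "y \<in> ball x \<epsilon>2" using that by (simp_all add: \<epsilon>_def dist_commute)
    then show "y \<in> U" "norm (G y - G x) \<le> g / 2"
      using \<epsilon>1(2)[of y] \<epsilon>2(2) by (auto simp: dist_norm)
  qed
  have "dist y z \<le> 4 * (\<Sum>j\<in>- {k}. \<bar>y $ j - z $ j\<bar>)"
    if y: "y \<in> \<Gamma>" "y \<in> ball x \<epsilon>" and z: "z \<in> \<Gamma>" "z \<in> ball x \<epsilon>" for y z
  proof -
    define w where "w = y - z"
    define R where "R = (\<Sum>j\<in>- {k}. \<bar>w $ j\<bar>)"
    \<comment> \<open>the deviation of \<open>\<phi>\<close> from its linearisation at \<open>x\<close> has small gradient on the whole ball\<close>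
    define \<psi> where "\<psi> u = \<phi> u - G x \<bullet> u" for u
    have "norm (\<psi> y - \<psi> z) \<le> g / 2 * norm (y - z)"
    proof (rule differentiable_bound[OF convex_ball _ _ y(2) z(2)])
      fix u assume u: "u \<in> ball x \<epsilon>"
      show "(\<psi> has_derivative (\<lambda>v. (G u - G x) \<bullet> v)) (at u within ball x \<epsilon>)"
        unfolding \<psi>_def inner_diff_left
        by (intro derivative_intros has_derivative_at_withinI[OF \<phi>] ball u)
      show "onorm (\<lambda>v. (G u - G x) \<bullet> v) \<le> g / 2"
      proof (rule onorm_bound)
        fix v show "norm ((G u - G x) \<bullet> v) \<le> g / 2 * norm v"
          using Cauchy_Schwarz_ineq2[of "G u - G x" v] mult_right_mono[OF ball(2)[OF u], of "norm v"]
          by auto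
      qed (use g in simp)
    qed
    moreover have "\<phi> y = 0" "\<phi> z = 0" using level y z ball(1) by auto
    ultimately have *: "\<bar>G x \<bullet> w\<bar> \<le> g / 2 * norm w"
      by (simp add: \<psi>_def w_def inner_diff_right abs_minus_commute)
    have split: "(\<Sum>j\<in>UNIV. f j) = f k + (\<Sum>j\<in>- {k}. f j)" for f :: "'n \<Rightarrow> real"
      by (subst sum.remove[of UNIV k]) (auto simp: Compl_eq_Diff_UNIV)
    have nw: "norm w \<le> \<bar>w $ k\<bar> + R"
      using norm_le_l1_cart[of w] by (simp add: split R_def)
    have "\<bar>\<Sum>j\<in>- {k}. G x $ j * w $ j\<bar> \<le> (\<Sum>j\<in>- {k}. \<bar>G x $ j * w $ j\<bar>)" by (rule sum_abs)
    also have "\<dots> \<le> (\<Sum>j\<in>- {k}. g * \<bar>w $ j\<bar>)"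
      unfolding abs_mult g_def by (intro sum_mono mult_right_mono k) auto
    also have "\<dots> = g * R" by (simp add: R_def sum_distrib_left)
    finally have rest: "\<bar>\<Sum>j\<in>- {k}. G x $ j * w $ j\<bar> \<le> g * R" .
    have "G x \<bullet> w = G x $ k * w $ k + (\<Sum>j\<in>- {k}. G x $ j * w $ j)"
      unfolding inner_vec_def by (simp add: split)
    then have "g * \<bar>w $ k\<bar> \<le> \<bar>G x \<bullet> w\<bar> + g * R"
      using rest unfolding g_def abs_mult[symmetric] by linarith
    also have "\<dots> \<le> g / 2 * (\<bar>w $ k\<bar> + R) + g * R"
      using * mult_left_mono[OF nw, of "g / 2"] g by linarith
    finally have "g * \<bar>w $ k\<bar> \<le> g * (\<bar>w $ k\<bar> / 2 + 3 / 2 * R)" by (simp add: algebra_simps)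
    then have "\<bar>w $ k\<bar> \<le> \<bar>w $ k\<bar> / 2 + 3 / 2 * R" using g by simp
    then have "norm w \<le> 4 * R" using nw by linarith
    then show ?thesis by (simp add: w_def R_def dist_norm)
  qed
  moreover have "0 < \<epsilon>" using \<epsilon>1(1) \<epsilon>2(1) by (simp add: \<epsilon>_def)
  ultimately show ?thesis by blast
qed

text \<open>
  Compactness makes the radius of the local graphs uniform. Only the threshold \<open>h0\<close> depends on the
  surface; the constant in front of \<open>h\<^sup>d\<^sup>-\<^sup>1\<close> does not.
\<close>

lemma compact_C2_hypersurface_small_piece_area:
  fixes \<Gamma> :: "(real^'n) set"
  assumes \<Gamma>: "compact \<Gamma>" "C2_hypersurface \<Gamma>"
  shows "\<exists>h0>0. \<forall>S h. S \<subseteq> \<Gamma> \<longrightarrow> diameter S \<le> h \<longrightarrow> 0 < h \<longrightarrow> h \<le> h0 \<longrightarrow>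
    hausdorff_outer (CARD('n) - 1) S
      \<le> ennreal (unit_ball_vol (real (CARD('n) - 1)) * (4 * real CARD('n) * h) ^ (CARD('n) - 1))"
proof -
  define P where "P B \<longleftrightarrow> (\<exists>k. \<forall>y\<in>\<Gamma> \<inter> B. \<forall>z\<in>\<Gamma> \<inter> B. dist y z \<le> 4 * (\<Sum>j\<in>- {k}. \<bar>y $ j - z $ j\<bar>))"
    for B :: "(real^'n) set"
  \<comment> \<open>the open sets over which the surface is a graph; \<open>e\<close> is a Lebesgue number of this cover\<close>
  define \<G> where "\<G> = {B. open B \<and> P B}"
  have "\<Gamma> \<subseteq> \<Union>\<G>"
  proof
    fix x assume "x \<in> \<Gamma>"
    then obtain \<epsilon> where "0 < \<epsilon>" "P (ball x \<epsilon>)"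
      using C2_hypersurface_locally_lipschitz_graph[OF \<Gamma>(2)] unfolding P_def by blast
    then show "x \<in> \<Union>\<G>" by (auto simp: \<G>_def intro!: exI[of _ "ball x \<epsilon>"])
  qed
  then obtain e where e: "0 < e" "\<And>x. x \<in> \<Gamma> \<Longrightarrow> \<exists>B\<in>\<G>. ball x e \<subseteq> B"
    by (rule Heine_Borel_lemma[OF \<Gamma>(1)]) (auto simp: \<G>_def)
  have "hausdorff_outer (CARD('n) - 1) S
      \<le> ennreal (unit_ball_vol (real (CARD('n) - 1)) * (4 * real CARD('n) * h) ^ (CARD('n) - 1))"
    if S: "S \<subseteq> \<Gamma>" "diameter S \<le> h" and h: "0 < h" "h \<le> e / 2" for S h
  proof (cases "S = {}")
    case False
    then obtain x where x: "x \<in> S" by auto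
    have bS: "bounded S" using S(1) \<Gamma>(1) compact_imp_bounded bounded_subset by blast
    from e(2)[of x] x S(1) obtain B where B: "P B" "ball x e \<subseteq> B" by (auto simp: \<G>_def)
    have "S \<subseteq> \<Gamma> \<inter> B"
    proof
      fix y assume y: "y \<in> S"
      then have "dist x y \<le> h" using diameter_bounded_bound[OF bS x y] S(2) by simp
      also have "\<dots> < e" using h e(1) by simp
      finally show "y \<in> \<Gamma> \<inter> B" using y S(1) B(2) by auto
    qed
    moreover obtain k where "\<And>y z. y \<in> \<Gamma> \<inter> B \<Longrightarrow> z \<in> \<Gamma> \<inter> B \<Longrightarrow> dist y z \<le> 4 * (\<Sum>j\<in>- {k}. \<bar>y $ j - z $ j\<bar>)"
      using B(1) unfolding P_def by blast
    ultimately show ?thesis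
      by (intro hausdorff_outer_lipschitz_graph_le[OF bS S(2) h(1), of 4 k]) auto
  qed simp
  then show ?thesis using e(1) by (intro exI[of _ "e / 2"]) auto
qed

section \<open>Mesh elements, norms and weights\<close>

lemma mesh_element_compact_convex:
  fixes K :: "(real^'n) set"
  assumes "mesh_element K"
  shows "compact K" "convex K"
proof -
  have "compact K \<and> convex K"
    using assms unfolding mesh_element_def
  proof
    assume "parallelotope K"
    then obtain A :: "real^'n^'n" and b where K: "K = (\<lambda>t. b + A *v t) ` cbox 0 1"
      unfolding parallelotope_def by blast
    have "K = (+) b ` ((*v) A ` cbox 0 1)" unfolding K by (simp add: image_image)
    moreover have "compact ((*v) A ` cbox 0 1)"
      by (intro compact_continuous_image linear_continuous_on matrix_vector_mul_bounded_linear compact_cbox)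
    moreover have "convex ((*v) A ` cbox 0 1)"
      by (intro convex_linear_image) auto
    ultimately show ?thesis using compact_translation convex_translation by metis
  qed (auto simp: compact_simplex convex_simplex)
  then show "compact K" "convex K" by auto
qed

lemma mesh_element_diameter_pos:
  fixes K :: "(real^'n) set"
  assumes K: "mesh_element K"
  shows "0 < diameter K"
proof -
  have "\<exists>x\<in>K. \<exists>y\<in>K. x \<noteq> y"
    using K unfolding mesh_element_def
  proof
    assume "int CARD('n) simplex K"
    then have "aff_dim K = int CARD('n)" by (rule aff_dim_simplex)
    then have "\<not> K \<subseteq> {a}" for a using aff_dim_subset[of K "{a}"] by auto
    then show ?thesis by (metis empty_subsetI insertI1 subsetI subset_singletonD singletonD)
  next
    assume "parallelotope K"
    then obtain A :: "real^'n^'n" and b where A: "invertible A" and K: "K = (\<lambda>t. b + A *v t) ` cbox 0 1"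
      unfolding parallelotope_def by blast
    have "(0 :: real^'n) \<in> cbox 0 1" "(1 :: real^'n) \<in> cbox 0 1" by (auto simp: mem_box_cart)
    moreover have "A *v 0 \<noteq> A *v 1"
      using inj_matrix_vector_mult[OF A] by (metis injD zero_neq_one)
    ultimately show ?thesis unfolding K by (metis add_left_cancel imageI)
  qed
  then obtain x y where xy: "x \<in> K" "y \<in> K" "x \<noteq> y" by blast
  have "dist x y \<le> diameter K"
    using xy mesh_element_compact_convex(1)[OF K] by (intro diameter_bounded_bound compact_imp_bounded)
  with xy(3) show ?thesis by (meson less_le_trans zero_less_dist_iff)
qed

lemma L2_norm_on_le:
  assumes c: "0 < c"
    and le: "(\<integral>\<^sup>+ x. ennreal ((f x)\<^sup>2) * indicator A x \<partial>M)
      \<le> ennreal (c\<^sup>2) * (\<integral>\<^sup>+ x. ennreal ((g x)\<^sup>2) * indicator B x \<partial>N)"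
  shows "L2_norm_on M A f \<le> ennreal c * L2_norm_on N B g"
proof -
  define I J where "I = (\<integral>\<^sup>+ x. ennreal ((f x)\<^sup>2) * indicator A x \<partial>M)"
    and "J = (\<integral>\<^sup>+ x. ennreal ((g x)\<^sup>2) * indicator B x \<partial>N)"
  have IJ: "I \<le> ennreal (c\<^sup>2) * J" using le by (simp add: I_def J_def)
  show ?thesis
  proof (cases "J = \<infinity>")
    case True
    then show ?thesis using c by (simp add: L2_norm_on_def Let_def ennreal_mult_top flip: J_def)
  next
    case False
    then obtain j where j: "J = ennreal j" "0 \<le> j" by (metis ennreal_cases infinity_ennreal_def)
    have "I \<le> ennreal (c\<^sup>2 * j)" using IJ j by (simp add: ennreal_mult)
    then obtain i where i: "I = ennreal i" "0 \<le> i" "i \<le> c\<^sup>2 * j"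
      using j(2) by (cases I) (auto simp: top_unique)
    have "sqrt i \<le> sqrt (c\<^sup>2 * j)" using i by simp
    also have "\<dots> = c * sqrt j" using c by (simp add: real_sqrt_mult)
    finally have "ennreal (sqrt i) \<le> ennreal c * ennreal (sqrt j)"
      using c j by (simp add: ennreal_leI flip: ennreal_mult)
    then show ?thesis
      unfolding L2_norm_on_def Let_def I_def[symmetric] J_def[symmetric] using i j by simp
  qed
qed

text \<open>
  The smallness of \<open>c0 h\<close> serves the value \<open>1\<close>, taken only where the volume ratio exceeds
  \<open>1 - c0 h \<ge> 1/2\<close>.
\<close>

lemma weight_bounds:
  assumes "c0 * diameter K \<le> 1/2"
  shows "0 \<le> weight c0 K D" "weight c0 K D \<le> 2 * (measure lborel (K \<inter> D) / measure lborel K)"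
    and "weight c0 K D \<noteq> 0 \<Longrightarrow> c0 * diameter K \<le> measure lborel (K \<inter> D) / measure lborel K"
proof -
  define r where "r = measure lborel (K \<inter> D) / measure lborel K"
  have "0 \<le> r" by (simp add: r_def)
  then show "0 \<le> weight c0 K D" "weight c0 K D \<le> 2 * (measure lborel (K \<inter> D) / measure lborel K)"
    "weight c0 K D \<noteq> 0 \<Longrightarrow> c0 * diameter K \<le> measure lborel (K \<inter> D) / measure lborel K"
    using assms unfolding weight_def Let_def r_def[symmetric] by (auto split: if_splits)
qed

section \<open>The weighted trace inequality on a cut element\<close>

text \<open>
  Outside the strip the interface does not meet \<open>K\<close>, so each of the two caps is a connected set in
  \<open>\<Omega>1 \<union> \<Omega>2\<close> and lies in a single phase. The strip takes at most half of the volume of \<open>K \<inter> D\<close>; the other half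
  is shared by the caps that lie in \<open>D\<close>, so one of these has at least a quarter of \<open>|K \<inter> D|\<close>.
\<close>

lemma one_cap_carries_phase:
  fixes K :: "(real^'n) set"
  assumes dim: "CARD('n) = 2 \<or> CARD('n) = 3"
    and K: "compact K" "convex K"
    and open_phases: "open \<Omega>1" "open \<Omega>2" and disjoint: "\<Omega>1 \<inter> \<Omega>2 = {}"
    and interior: "interior K \<subseteq> \<Omega>1 \<union> \<Omega>2 \<union> \<Gamma>" and D: "D = \<Omega>1 \<or> D = \<Omega>2"
    and n: "norm n = 1" and strip: "K \<inter> \<Gamma> \<subseteq> {x. t \<le> n \<bullet> x \<and> n \<bullet> x \<le> t + \<delta>}" and \<delta>: "0 \<le> \<delta>"
    and big: "2 * \<delta> * diameter K ^ (CARD('n) - 1) \<le> measure lborel (K \<inter> D)"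
    and pos: "0 < measure lborel (K \<inter> D)"
  shows "\<exists>W\<in>{cap K n (t + \<delta>), cap K (- n) (- t)}.
    W \<subseteq> K \<inter> D \<and> measure lborel (K \<inter> D) \<le> 4 * measure lborel W"
proof -
  define S where "S = interior K \<inter> {x. t \<le> n \<bullet> x \<and> n \<bullet> x \<le> t + \<delta>}"
  define A B where "A = cap K n (t + \<delta>)" and "B = cap K (- n) (- t)"
  have bK: "bounded K" using K(1) by (rule compact_imp_bounded)
  have cK: "closed K" using K(1) by (rule compact_imp_closed)
  have iK: "interior K \<subseteq> K" by (rule interior_subset)
  have oD: "open D" using D open_phases by auto
  have AB: "A \<subseteq> interior K" "B \<subseteq> interior K" by (auto simp: A_def B_def cap_def)
  have fm: "X \<in> fmeasurable lborel" if "X \<subseteq> K" "X \<in> sets borel" for X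
  proof -
    have "bounded X" using bK that(1) by (rule bounded_subset)
    then show ?thesis using that(2) emeasure_bounded_finite by (intro fmeasurableI) auto
  qed
  have slab: "{x. t \<le> n \<bullet> x \<and> n \<bullet> x \<le> t + \<delta>} = {x. n \<bullet> x \<ge> t} \<inter> {x. n \<bullet> x \<le> t + \<delta>}" by auto
  have bor: "A \<inter> D \<in> sets borel" "B \<inter> D \<in> sets borel" "S \<in> sets borel" "K - interior K \<in> sets borel" "K \<inter> D \<in> sets borel"
    using oD cK unfolding A_def B_def S_def slab
    by (auto simp: open_cap open_Int closed_halfspace_ge closed_halfspace_le intro!: sets.Int borel_open borel_closed sets.Diff)
  have "measure lborel S \<le> \<bar>\<delta>\<bar> * diameter K ^ (CARD('n) - 1)"
  proof (rule measure_slab_le[OF dim _ _ n])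
    show "bounded S" "diameter S \<le> diameter K"
      using bK iK by (auto simp: S_def intro!: diameter_subset intro: bounded_subset)
    show "S \<subseteq> {x. t \<le> n \<bullet> x \<and> n \<bullet> x \<le> t + \<delta>}" by (auto simp: S_def)
  qed (use bor in simp)
  with big \<delta> have S_le: "2 * measure lborel S \<le> measure lborel (K \<inter> D)" by simp
  have null: "measure lborel (K - interior K) = 0"
  proof -
    have "negligible (K - interior K)"
      using negligible_convex_frontier[OF K(2)] cK by (simp add: frontier_def)
    then have "measure lebesgue (K - interior K) = 0" by (rule negligible_imp_measure0)
    then show ?thesis using bor(4) by (simp add: measure_completion)
  qed
  have sub: "K \<inter> D \<subseteq> ((A \<inter> D) \<union> (B \<inter> D)) \<union> (S \<union> (K - interior K))"
    by (auto simp: A_def B_def S_def cap_def)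
  have fms: "A \<inter> D \<in> fmeasurable lborel" "B \<inter> D \<in> fmeasurable lborel" "S \<in> fmeasurable lborel"
    "K - interior K \<in> fmeasurable lborel"
    using AB iK by (auto intro!: fm bor simp: S_def)
  have "measure lborel (K \<inter> D) \<le> measure lborel (((A \<inter> D) \<union> (B \<inter> D)) \<union> (S \<union> (K - interior K)))"
    using sub bor fms by (intro measure_mono_fmeasurable) auto
  also have "\<dots> \<le> (measure lborel (A \<inter> D) + measure lborel (B \<inter> D)) + (measure lborel S + measure lborel (K - interior K))"
    using fms by (intro order_trans[OF measure_Un_le] add_mono measure_Un_le) (auto simp: fmeasurable_def)
  finally have cover_le: "measure lborel (K \<inter> D) \<le> (measure lborel (A \<inter> D) + measure lborel (B \<inter> D)) + (measure lborel S + measure lborel (K - interior K))" .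
  have sum: "measure lborel (K \<inter> D) \<le> 2 * measure lborel (A \<inter> D) + 2 * measure lborel (B \<inter> D)"
    using cover_le S_le null by linarith
  have one_phase: "W \<subseteq> D" if W: "convex W" "W \<subseteq> interior K" "W \<inter> \<Gamma> = {}" "W \<inter> D \<noteq> {}" for W
  proof -
    have "W \<subseteq> \<Omega>1 \<union> \<Omega>2" using W(2,3) interior by auto
    then have "\<Omega>1 \<inter> W = {} \<or> \<Omega>2 \<inter> W = {}"
      using disjoint by (intro connectedD[OF convex_connected[OF W(1)] open_phases]) auto
    then show ?thesis using \<open>W \<subseteq> \<Omega>1 \<union> \<Omega>2\<close> W(4) D by auto
  qed
  have off: "A \<inter> \<Gamma> = {}" "B \<inter> \<Gamma> = {}" using strip iK by (auto simp: A_def B_def cap_def)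
  have conv: "convex A" "convex B" by (simp_all add: A_def B_def convex_cap K(2))
  have pick: "W \<subseteq> K \<inter> D \<and> measure lborel (K \<inter> D) \<le> 4 * measure lborel W"
    if W: "convex W" "W \<subseteq> interior K" "W \<inter> \<Gamma> = {}" "measure lborel (K \<inter> D) \<le> 4 * measure lborel (W \<inter> D)" for W
  proof -
    have "W \<inter> D \<noteq> {}" using W(4) pos by auto
    then have "W \<subseteq> D" using one_phase W by blast
    moreover from this have "W \<inter> D = W" by auto
    ultimately show ?thesis using W(2,4) iK by auto
  qed
  from sum consider "measure lborel (K \<inter> D) \<le> 4 * measure lborel (A \<inter> D)"
    | "measure lborel (K \<inter> D) \<le> 4 * measure lborel (B \<inter> D)" by linarith
  then show ?thesis
  proof cases
    case 1
    with pick[OF conv(1) AB(1) off(1)] show ?thesis unfolding A_def by blast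
  next
    case 2
    with pick[OF conv(2) AB(2) off(2)] show ?thesis unfolding B_def by blast
  qed
qed

lemma pointwise_bound_on_interface:
  assumes dim: "CARD('n) = 2 \<or> CARD('n) = 3"
  shows "\<exists>M>0. \<forall>v\<in>polynomials_upto p. \<forall>K \<Gamma> \<Omega>1 \<Omega>2 D n t \<delta>. \<forall>x::real^'n.
    compact K \<longrightarrow> convex K \<longrightarrow> 0 < diameter K \<longrightarrow> open \<Omega>1 \<longrightarrow> open \<Omega>2 \<longrightarrow> \<Omega>1 \<inter> \<Omega>2 = {} \<longrightarrow>
    interior K \<subseteq> \<Omega>1 \<union> \<Omega>2 \<union> \<Gamma> \<longrightarrow> D = \<Omega>1 \<or> D = \<Omega>2 \<longrightarrow>
    norm n = 1 \<longrightarrow> K \<inter> \<Gamma> \<subseteq> {x. t \<le> n \<bullet> x \<and> n \<bullet> x \<le> t + \<delta>} \<longrightarrow> 0 \<le> \<delta> \<longrightarrow>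
    2 * \<delta> * diameter K ^ (CARD('n) - 1) \<le> measure lborel (K \<inter> D) \<longrightarrow> x \<in> K \<inter> \<Gamma> \<longrightarrow>
    ennreal ((v x)\<^sup>2) * ennreal (measure lborel (K \<inter> D))
      \<le> ennreal M * (\<integral>\<^sup>+ y. ennreal ((v y)\<^sup>2) * indicator (K \<inter> D) y \<partial>lborel)"
proof -
  obtain M where M: "M > 0" and cap_bound: "\<forall>v\<in>polynomials_upto p. \<forall>K n t \<delta>. \<forall>x::real^'n.
    compact K \<longrightarrow> convex K \<longrightarrow> 0 < diameter K \<longrightarrow> norm n = 1 \<longrightarrow> 0 \<le> \<delta> \<longrightarrow>
    \<delta> / 2 * diameter K ^ (CARD('n) - 1) \<le> measure lborel (cap K n (t + \<delta>)) \<longrightarrow>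
    x \<in> K \<longrightarrow> t \<le> n \<bullet> x \<longrightarrow>
    ennreal ((v x)\<^sup>2) * emeasure lborel (cap K n (t + \<delta>))
      \<le> ennreal M * (\<integral>\<^sup>+ y. ennreal ((v y)\<^sup>2) * indicator (cap K n (t + \<delta>)) y \<partial>lborel)"
    using pointwise_bound_by_L2_on_cap[OF dim, of p] by auto
  have "ennreal ((v x)\<^sup>2) * ennreal (measure lborel (K \<inter> D))
      \<le> ennreal (4 * M) * (\<integral>\<^sup>+ y. ennreal ((v y)\<^sup>2) * indicator (K \<inter> D) y \<partial>lborel)"
    if v: "v \<in> polynomials_upto p" and K: "compact K" "convex K" "0 < diameter K"
    and phases: "open \<Omega>1" "open \<Omega>2" "\<Omega>1 \<inter> \<Omega>2 = {}" "interior K \<subseteq> \<Omega>1 \<union> \<Omega>2 \<union> \<Gamma>" "D = \<Omega>1 \<or> D = \<Omega>2"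
    and n: "norm n = 1" and strip: "K \<inter> \<Gamma> \<subseteq> {x. t \<le> n \<bullet> x \<and> n \<bullet> x \<le> t + \<delta>}" and \<delta>: "0 \<le> \<delta>"
    and big: "2 * \<delta> * diameter K ^ (CARD('n) - 1) \<le> measure lborel (K \<inter> D)"
    and x: "x \<in> K \<inter> \<Gamma>"
    for v :: "real^'n \<Rightarrow> real" and K \<Gamma> \<Omega>1 \<Omega>2 D n t \<delta> x
  proof (cases "measure lborel (K \<inter> D) = 0")
    case False
    then have pos: "0 < measure lborel (K \<inter> D)" by (simp add: zero_less_measure_iff)
    obtain W where W: "W = cap K n (t + \<delta>) \<or> W = cap K (- n) (- t)" "W \<subseteq> K \<inter> D"
      "measure lborel (K \<inter> D) \<le> 4 * measure lborel W"
      using one_cap_carries_phase[OF dim K(1,2) phases n strip \<delta> big pos] by auto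
    have W_big: "\<delta> / 2 * diameter K ^ (CARD('n) - 1) \<le> measure lborel W" using big W(3) by linarith
    have x': "x \<in> K" "t \<le> n \<bullet> x" "n \<bullet> x \<le> t + \<delta>" using x strip by auto
    have W_bound: "ennreal ((v x)\<^sup>2) * emeasure lborel W
        \<le> ennreal M * (\<integral>\<^sup>+ y. ennreal ((v y)\<^sup>2) * indicator W y \<partial>lborel)"
      using W(1)
    proof
      assume "W = cap K n (t + \<delta>)"
      then show ?thesis
        using cap_bound[rule_format, OF v K n \<delta>, of t x] W_big x' by simp
    next
      assume "W = cap K (- n) (- t)"
      then show ?thesis
        using cap_bound[rule_format, OF v K _ \<delta>, of "- n" "- (t + \<delta>)" x] n W_big x' by simp
    qed
    have "open W" using W(1) open_cap by auto
    moreover have "emeasure lborel W < \<infinity>" using W(2) compact_imp_bounded[OF K(1)] bounded_subset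
      by (blast intro: emeasure_bounded_finite)
    ultimately have "emeasure lborel W = ennreal (measure lborel W)"
      by (intro emeasure_eq_ennreal_measure) auto
    then have "ennreal (measure lborel (K \<inter> D)) \<le> ennreal 4 * emeasure lborel W"
      using ennreal_leI[OF W(3)] by (simp add: ennreal_mult)
    then have "ennreal ((v x)\<^sup>2) * ennreal (measure lborel (K \<inter> D))
        \<le> ennreal ((v x)\<^sup>2) * (ennreal 4 * emeasure lborel W)"
      by (intro mult_left_mono) auto
    also have "\<dots> = ennreal 4 * (ennreal ((v x)\<^sup>2) * emeasure lborel W)" by (simp only: mult_ac)
    also have "\<dots> \<le> ennreal 4 * (ennreal M * (\<integral>\<^sup>+ y. ennreal ((v y)\<^sup>2) * indicator W y \<partial>lborel))"
      by (intro mult_left_mono W_bound) auto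
    also have "\<dots> \<le> ennreal 4 * (ennreal M * (\<integral>\<^sup>+ y. ennreal ((v y)\<^sup>2) * indicator (K \<inter> D) y \<partial>lborel))"
      using W(2) by (intro mult_left_mono nn_integral_mono) (auto simp: indicator_def)
    also have "\<dots> = ennreal (4 * M) * (\<integral>\<^sup>+ y. ennreal ((v y)\<^sup>2) * indicator (K \<inter> D) y \<partial>lborel)"
      using M by (simp add: ennreal_mult mult.assoc)
    finally show ?thesis .
  qed simp
  then show ?thesis using M by (intro exI[of _ "4 * M"]) auto
qed

text \<open>
  The factor \<open>|K \<inter> D|\<close> in the pointwise bound may be small, but the weight is at most \<open>2 |K \<inter> D| / |K|\<close>, so it
  cancels. What remains is the area of the interface piece divided by \<open>|K|\<close>, which is of order \<open>1 / h\<close>.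
\<close>

lemma weighted_trace_integral_le:
  fixes K \<Gamma> D :: "(real^'n) set"
  assumes \<Gamma>: "closed \<Gamma>" "closed K"
    and area: "hausdorff_outer (CARD('n) - 1) (K \<inter> \<Gamma>) \<le> ennreal (A * diameter K ^ (CARD('n) - 1))" "0 \<le> A"
    and vol: "0 < measure lborel K" "diameter K ^ CARD('n) \<le> \<gamma> * measure lborel K" and h: "0 < diameter K"
    and \<kappa>: "0 \<le> \<kappa>" "\<kappa> \<le> 2 * (measure lborel (K \<inter> D) / measure lborel K)" and M: "0 \<le> M"
    and pw: "\<And>x. x \<in> K \<inter> \<Gamma> \<Longrightarrow> \<kappa> \<noteq> 0 \<Longrightarrow> ennreal ((v x)\<^sup>2) * ennreal (measure lborel (K \<inter> D)) \<le> ennreal M * I"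
  shows "(\<integral>\<^sup>+ x. ennreal ((sqrt \<kappa> * v x)\<^sup>2) * indicator (K \<inter> \<Gamma>) x \<partial>surface_measure)
    \<le> ennreal (2 * M * A * \<gamma> / diameter K) * I"
proof -
  define k where "k = measure lborel K"
  have k: "0 < k" "diameter K ^ CARD('n) \<le> \<gamma> * k" using vol by (simp_all add: k_def)
  have point: "ennreal ((sqrt \<kappa> * v x)\<^sup>2) \<le> ennreal (2 * M / k) * I" if x: "x \<in> K \<inter> \<Gamma>" for x
  proof (cases "\<kappa> = 0")
    case False
    have "(sqrt \<kappa> * v x)\<^sup>2 = \<kappa> * (v x)\<^sup>2" using \<kappa> by (simp add: power_mult_distrib)
    also have "\<dots> \<le> 2 * (measure lborel (K \<inter> D) / k) * (v x)\<^sup>2"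
      using \<kappa>(2) unfolding k_def by (intro mult_right_mono) auto
    also have "\<dots> = (2 / k) * ((v x)\<^sup>2 * measure lborel (K \<inter> D))" by simp
    finally have "ennreal ((sqrt \<kappa> * v x)\<^sup>2) \<le> ennreal (2 / k) * (ennreal ((v x)\<^sup>2) * ennreal (measure lborel (K \<inter> D)))"
      using k by (simp add: ennreal_leI flip: ennreal_mult)
    also have "\<dots> \<le> ennreal (2 / k) * (ennreal M * I)"
      by (intro mult_left_mono pw x False) auto
    also have "\<dots> = ennreal (2 * M / k) * I"
      using k M by (simp add: mult.assoc[symmetric] flip: ennreal_mult)
    finally show ?thesis .
  qed simp
  have set: "K \<inter> \<Gamma> \<in> sets borel" using \<Gamma> by (intro borel_closed closed_Int)
  have "(\<integral>\<^sup>+ x. ennreal ((sqrt \<kappa> * v x)\<^sup>2) * indicator (K \<inter> \<Gamma>) x \<partial>surface_measure)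
      \<le> (\<integral>\<^sup>+ x. (ennreal (2 * M / k) * I) * indicator (K \<inter> \<Gamma>) x \<partial>surface_measure)"
    using point by (intro nn_integral_mono) (auto simp: indicator_def)
  also have "\<dots> = (ennreal (2 * M / k) * I) * hausdorff_outer (CARD('n) - 1) (K \<inter> \<Gamma>)"
    using set by (subst nn_integral_cmult_indicator) (auto simp: emeasure_hausdorff_measure)
  also have "\<dots> \<le> (ennreal (2 * M / k) * I) * ennreal (A * diameter K ^ (CARD('n) - 1))"
    by (intro mult_left_mono area) auto
  also have "\<dots> = ennreal (2 * M / k * (A * diameter K ^ (CARD('n) - 1))) * I"
    using k M area(2) h by (subst ennreal_mult) (auto simp: mult_ac)
  also have "\<dots> \<le> ennreal (2 * M * A * \<gamma> / diameter K) * I"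
  proof (intro mult_right_mono ennreal_leI)
    have "CARD('n) = Suc (CARD('n) - 1)" by simp
    then have "diameter K ^ CARD('n) = diameter K * diameter K ^ (CARD('n) - 1)" by (metis power_Suc)
    then have "diameter K ^ (CARD('n) - 1) \<le> \<gamma> * k / diameter K"
      using k(2) h by (simp add: field_simps)
    then have "2 * M / k * (A * diameter K ^ (CARD('n) - 1)) \<le> 2 * M / k * (A * (\<gamma> * k / diameter K))"
      using M area(2) k(1) by (intro mult_left_mono) auto
    then show "2 * M / k * (A * diameter K ^ (CARD('n) - 1)) \<le> 2 * M * A * \<gamma> / diameter K"
      using k(1) by simp
  qed simp
  finally show ?thesis .
qed

theorem lemma3p4:
  fixes \<Omega> :: "(real^'n) set" and p :: nat and \<gamma>0 \<gamma>1 c0 :: real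
  assumes "CARD('n) = 2 \<or> CARD('n) = 3"
    and "polytopal_domain \<Omega>"
    and "c0 \<ge> 2 * \<gamma>0 * \<gamma>1"
  shows "\<exists>C>0. \<forall>\<Gamma> \<Omega>1 \<Omega>2. C2_interface \<Omega> \<Gamma> \<Omega>1 \<Omega>2 \<longrightarrow>
    (\<exists>h0>0. \<forall>\<T>.
       mesh_family \<Omega> \<T> \<and>
       (\<forall>T\<in>\<T>. \<forall>K\<in>T. diameter K ^ CARD('n) \<le> \<gamma>0 * measure lborel K) \<and>
       (\<forall>T\<in>\<T>. \<forall>K\<in>cut_elements \<Gamma> T. in_strip_of_width (\<gamma>1 * (diameter K)\<^sup>2) (K \<inter> \<Gamma>)) \<longrightarrow>
       (\<forall>T\<in>\<T>. mesh_size T \<le> h0 \<longrightarrow>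
          (\<forall>K\<in>cut_elements \<Gamma> T. \<forall>D\<in>{\<Omega>1, \<Omega>2}. \<forall>v\<in>polynomials_upto p.
             L2_norm_on surface_measure (K \<inter> \<Gamma>) (\<lambda>x. sqrt (weight c0 K D) * v x)
               \<le> ennreal (C / sqrt (diameter K)) * L2_norm_on lborel (K \<inter> D) v)))"
proof -
  let ?d = "CARD('n)"
  obtain M where M: "M > 0" and pointwise: "\<forall>v\<in>polynomials_upto p. \<forall>K \<Gamma> \<Omega>1 \<Omega>2 D n t \<delta>. \<forall>x::real^'n.
    compact K \<longrightarrow> convex K \<longrightarrow> 0 < diameter K \<longrightarrow> open \<Omega>1 \<longrightarrow> open \<Omega>2 \<longrightarrow> \<Omega>1 \<inter> \<Omega>2 = {} \<longrightarrow>
    interior K \<subseteq> \<Omega>1 \<union> \<Omega>2 \<union> \<Gamma> \<longrightarrow> D = \<Omega>1 \<or> D = \<Omega>2 \<longrightarrow>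
    norm n = 1 \<longrightarrow> K \<inter> \<Gamma> \<subseteq> {x. t \<le> n \<bullet> x \<and> n \<bullet> x \<le> t + \<delta>} \<longrightarrow> 0 \<le> \<delta> \<longrightarrow>
    2 * \<delta> * diameter K ^ (?d - 1) \<le> measure lborel (K \<inter> D) \<longrightarrow> x \<in> K \<inter> \<Gamma> \<longrightarrow>
    ennreal ((v x)\<^sup>2) * ennreal (measure lborel (K \<inter> D))
      \<le> ennreal M * (\<integral>\<^sup>+ y. ennreal ((v y)\<^sup>2) * indicator (K \<inter> D) y \<partial>lborel)"
    using pointwise_bound_on_interface[OF assms(1), of p] by auto
  define A where "A = unit_ball_vol (real (?d - 1)) * (4 * real ?d) ^ (?d - 1)"
  define C where "C = sqrt (2 * M * A * (\<bar>\<gamma>0\<bar> + 1))"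
  have A: "0 < A" by (simp add: A_def)
  have C: "0 < C" "C\<^sup>2 = 2 * M * A * (\<bar>\<gamma>0\<bar> + 1)" using A M by (simp_all add: C_def)
  have \<Omega>: "open \<Omega>" "bounded \<Omega>" "convex \<Omega>"
    using assms(2) by (simp_all add: polytopal_domain_def)
  have uniform: "\<exists>h0>0. \<forall>\<T>.
       mesh_family \<Omega> \<T> \<and>
       (\<forall>T\<in>\<T>. \<forall>K\<in>T. diameter K ^ ?d \<le> \<gamma>0 * measure lborel K) \<and>
       (\<forall>T\<in>\<T>. \<forall>K\<in>cut_elements \<Gamma> T. in_strip_of_width (\<gamma>1 * (diameter K)\<^sup>2) (K \<inter> \<Gamma>)) \<longrightarrow>
       (\<forall>T\<in>\<T>. mesh_size T \<le> h0 \<longrightarrow>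
          (\<forall>K\<in>cut_elements \<Gamma> T. \<forall>D\<in>{\<Omega>1, \<Omega>2}. \<forall>v\<in>polynomials_upto p.
             L2_norm_on surface_measure (K \<inter> \<Gamma>) (\<lambda>x. sqrt (weight c0 K D) * v x)
               \<le> ennreal (C / sqrt (diameter K)) * L2_norm_on lborel (K \<inter> D) v))"
    if interface: "C2_interface \<Omega> \<Gamma> \<Omega>1 \<Omega>2" for \<Gamma> \<Omega>1 \<Omega>2
  proof -
    have I: "open \<Omega>1" "open \<Omega>2" "\<Omega>1 \<inter> \<Omega>2 = {}" "\<Omega>1 \<union> \<Omega>2 = \<Omega> - \<Gamma>" "\<Gamma> = frontier \<Omega>1" "C2_hypersurface \<Gamma>"
      using interface unfolding C2_interface_def by blast+
    have "bounded \<Omega>1" using I(4) \<Omega>(2) by (auto intro: bounded_subset)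
    then have \<Gamma>: "compact \<Gamma>" unfolding I(5) by (rule compact_frontier_bounded)
    obtain h1 where h1: "0 < h1" "\<forall>S h. S \<subseteq> \<Gamma> \<longrightarrow> diameter S \<le> h \<longrightarrow> 0 < h \<longrightarrow> h \<le> h1 \<longrightarrow>
        hausdorff_outer (?d - 1) S \<le> ennreal (unit_ball_vol (real (?d - 1)) * (4 * real ?d * h) ^ (?d - 1))"
      using compact_C2_hypersurface_small_piece_area[OF \<Gamma> I(6)] by auto
    \<comment> \<open>the second entry makes \<open>c0 h \<le> 1/2\<close>\<close>
    define h0 where "h0 = min h1 (1 / (2 * (\<bar>c0\<bar> + 1)))"
    have h0: "0 < h0" using h1(1) by (simp add: h0_def)
    have estimate: "L2_norm_on surface_measure (K \<inter> \<Gamma>) (\<lambda>x. sqrt (weight c0 K D) * v x)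
               \<le> ennreal (C / sqrt (diameter K)) * L2_norm_on lborel (K \<inter> D) v"
      if family: "mesh_family \<Omega> \<T>"
        and shape: "\<forall>T\<in>\<T>. \<forall>K\<in>T. diameter K ^ ?d \<le> \<gamma>0 * measure lborel K"
        and strips: "\<forall>T\<in>\<T>. \<forall>K\<in>cut_elements \<Gamma> T. in_strip_of_width (\<gamma>1 * (diameter K)\<^sup>2) (K \<inter> \<Gamma>)"
        and T: "T \<in> \<T>" "mesh_size T \<le> h0" and cut: "K \<in> cut_elements \<Gamma> T"
        and D: "D \<in> {\<Omega>1, \<Omega>2}" and v: "v \<in> polynomials_upto p" for \<T> T K D v
    proof -
      define h where "h = diameter K"
      have KT: "K \<in> T" and e_pos: "emeasure surface_measure (K \<inter> \<Gamma>) \<noteq> 0"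
        using cut by (simp_all add: cut_elements_def)
      have part: "conforming_partition \<Omega> T" using family T(1) by (simp add: mesh_family_def)
      then have "mesh_element K" "finite T" "K \<subseteq> closure \<Omega>"
        using KT by (auto simp: conforming_partition_def)
      then have K: "compact K" "convex K" "0 < h"
        by (simp_all add: h_def mesh_element_compact_convex mesh_element_diameter_pos)
      have "h \<le> mesh_size T" unfolding mesh_size_def h_def using KT \<open>finite T\<close> by (intro Max_ge) auto
      then have h: "h \<le> h0" using T(2) by simp
      have "c0 * h \<le> (\<bar>c0\<bar> + 1) * (1 / (2 * (\<bar>c0\<bar> + 1)))"
        using h K(3) by (intro mult_mono) (auto simp: h0_def)
      also have "\<dots> = 1/2" by (simp add: field_simps)
      finally have c0h: "c0 * diameter K \<le> 1/2" by (simp add: h_def)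
      have "interior K \<subseteq> interior (closure \<Omega>)" using \<open>K \<subseteq> closure \<Omega>\<close> by (rule interior_mono)
      also have "\<dots> = \<Omega>" using \<Omega> by (simp add: convex_interior_closure interior_open)
      finally have int: "interior K \<subseteq> \<Omega>1 \<union> \<Omega>2 \<union> \<Gamma>" using I(4) by auto
      obtain n t where n: "norm n = 1" and strip: "K \<inter> \<Gamma> \<subseteq> {x. t \<le> n \<bullet> x \<and> n \<bullet> x \<le> t + \<gamma>1 * h\<^sup>2}"
        using strips T(1) cut unfolding in_strip_of_width_def h_def by blast
      have "K \<inter> \<Gamma> \<noteq> {}" using e_pos by auto
      then have "0 \<le> \<gamma>1 * h\<^sup>2" using strip by force
      then have \<gamma>1: "0 \<le> \<gamma>1" using K(3) by (simp add: zero_le_mult_iff)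
      have shapeK: "h ^ ?d \<le> \<gamma>0 * measure lborel K" using shape T(1) KT by (simp add: h_def)
      moreover have "0 < h ^ ?d" using K(3) by simp
      ultimately have vol: "0 < measure lborel K" by (metis less_le_trans less_irrefl measure_nonneg mult_zero_right order_le_less)
      have shape': "h ^ ?d \<le> (\<bar>\<gamma>0\<bar> + 1) * measure lborel K"
        using shapeK by (rule order_trans) (intro mult_right_mono, auto)
      have "diameter (K \<inter> \<Gamma>) \<le> h"
        unfolding h_def using K(1) by (intro diameter_subset compact_imp_bounded) auto
      then have area: "hausdorff_outer (?d - 1) (K \<inter> \<Gamma>) \<le> ennreal (A * diameter K ^ (?d - 1))"
        using h1(2)[rule_format, of "K \<inter> \<Gamma>" h] K(3) h
        by (simp add: A_def h0_def power_mult_distrib mult.assoc flip: h_def)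
      have pw: "ennreal ((v x)\<^sup>2) * ennreal (measure lborel (K \<inter> D))
          \<le> ennreal M * (\<integral>\<^sup>+ y. ennreal ((v y)\<^sup>2) * indicator (K \<inter> D) y \<partial>lborel)"
        if x: "x \<in> K \<inter> \<Gamma>" and \<kappa>: "weight c0 K D \<noteq> 0" for x
      proof (rule pointwise[rule_format, OF v K(1,2) _ I(1-3) int _ n strip _ _ x])
        \<comment> \<open>a nonzero weight means \<open>|K \<inter> D| \<ge> c0 h |K|\<close>, and \<open>c0 \<ge> 2 \<gamma>0 \<gamma>1\<close> makes this at least twice the strip\<close>
        show "2 * (\<gamma>1 * h\<^sup>2) * diameter K ^ (?d - 1) \<le> measure lborel (K \<inter> D)"
        proof -
          have "?d = Suc (?d - 1)" by simp
          then have "h ^ ?d = h * h ^ (?d - 1)" by (metis power_Suc)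
          then have "2 * (\<gamma>1 * h\<^sup>2) * h ^ (?d - 1) = 2 * \<gamma>1 * h * h ^ ?d"
            by (simp add: power2_eq_square)
          also have "\<dots> \<le> 2 * \<gamma>1 * h * (\<gamma>0 * measure lborel K)"
            using \<gamma>1 K(3) by (intro mult_left_mono shapeK) auto
          also have "\<dots> = (2 * \<gamma>0 * \<gamma>1) * (h * measure lborel K)" by simp
          also have "\<dots> \<le> c0 * (h * measure lborel K)"
            using assms(3) K(3) vol by (intro mult_right_mono) auto
          also have "\<dots> \<le> measure lborel (K \<inter> D)"
            using weight_bounds(3)[OF c0h \<kappa>] vol by (simp add: h_def field_simps)
          finally show ?thesis by (simp add: h_def)
        qed
      qed (use D K(3) \<open>0 \<le> \<gamma>1 * h\<^sup>2\<close> in \<open>auto simp: h_def\<close>)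
      show ?thesis
      proof (rule L2_norm_on_le)
        have "(C / sqrt (diameter K))\<^sup>2 = 2 * M * A * (\<bar>\<gamma>0\<bar> + 1) / diameter K"
          using C(2) K(3) by (simp add: power_divide h_def)
        then show "(\<integral>\<^sup>+ x. ennreal ((sqrt (weight c0 K D) * v x)\<^sup>2) * indicator (K \<inter> \<Gamma>) x \<partial>surface_measure)
            \<le> ennreal ((C / sqrt (diameter K))\<^sup>2) * (\<integral>\<^sup>+ x. ennreal ((v x)\<^sup>2) * indicator (K \<inter> D) x \<partial>lborel)"
          using weighted_trace_integral_le[OF compact_imp_closed[OF \<Gamma>] compact_imp_closed[OF K(1)] area
              less_imp_le[OF A] vol shape'[unfolded h_def] K(3)[unfolded h_def]
              weight_bounds(1,2)[OF c0h] less_imp_le[OF M] pw]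
          by simp
      qed (use C(1) K(3) in \<open>simp add: h_def\<close>)
    qed
    show ?thesis
      by (intro exI[of _ h0] conjI h0 allI impI ballI) (elim conjE, rule estimate)
  qed
  show ?thesis
    by (rule exI[of _ C], rule conjI[OF C(1)], intro allI impI, rule uniform)
qed

end
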